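(* Let $G$ be a Morse local-to-global group generated by the finite set $A$. For a subgroup $H<G$, let $L_H\subseteq A^\star$ be the language of all geodesic words representing elements of $H$. The subgroup $H$ is stable if and only if $L_H$ is a regular language all of whose elements are $M$-Morse geodesic words for some Morse gauge $M$ (the same $M$ for all elements of $L_H$). Moreover, if $H$ is stable, there exists a sublanguage $J_H\subseteq L_H$ such that $J_H$ is regular and each element of $H$ is represented by exactly one word in $J_H$.
   Context: All finite generating sets are symmetric ($A=A^{-1}$). $A^\star$ is the free monoid on $A$; a language with alphabet $A$ is a subset of $A^\star$; it is regular if it is accepted by a finite state automaton. For $w\in A^\star$, $\overline{w}\in G$ is the element it represents. $\mathrm{Cay}(G,A)$ is the Cayley graph (vertices $g\in G$, $g,h$ joined by an edge labeled $g^{-1}h$ if $g^{-1}h\in A$, edges of length $1$). A word $w\in A^\star$ is a geodesic word if the path in $\mathrm{Cay}(G,A)$ from the identity $e$ to $\overline{w}$ labeled by $w$ is a geodesic; it is an $M$-Morse geodesic word if this geodesic is $M$-Morse. Morse quasi-geodesics: let $X$ be a metric space and $I\subseteq\mathbb{R}$ a closed interval. A map $\gamma:I\to X$ is a $(k,c)$-quasi-geodesic ($k\ge1$, $c\ge0$) if $\frac1k|s-t|-c\le d(\gamma(s),\gamma(t))\le k|s-t|+c$ for all $s,t\in I$; a geodesic is a $(1,0)$-quasi-geodesic. A Morse gauge is a function $M:[1,\infty)\times[0,\infty)\to[0,\infty)$. A quasi-geodesic $\gamma:I\to X$ is $M$-Morse if for every $[s,t]\subseteq I$, every $(k,c)$-quasi-geodesic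 with endpoints $\gamma(s),\gamma(t)$ is contained in the $M(k,c)$-neighborhood of $\gamma|_{[s,t]}$. An $(M;k,c)$-Morse quasi-geodesic is an $M$-Morse $(k,c)$-quasi-geodesic. For $B\ge0$, $\gamma:I\to X$ is a $(B;M;k,c)$-local Morse quasi-geodesic if $\gamma|_{[s,t]}$ is an $(M;k,c)$-Morse quasi-geodesic for every $[s,t]\subseteq I$ with $|s-t|\le B$. Morse local-to-global: $X$ is a Morse local-to-global space if for every Morse gauge $M$ and $k\ge1$, $c\ge0$ there exist $B\ge0$, a Morse gauge $M'$, and $k'\ge1$, $c'\ge0$ such that every $(B;M;k,c)$-local Morse quasi-geodesic is an $(M';k',c')$-Morse quasi-geodesic. A Morse local-to-global group is a finitely generated group some (equivalently, every) Cayley graph of which, with respect to a finite generating set, is a Morse local-to-global space. Stable subgroups: $H\le G$ is $(M,k)$-stable in $\mathrm{Cay}(G,A)$ if for every $h\in H$ every geodesic in $\mathrm{Cay}(G,A)$ from $e$ to $h$ is $M$-Morse and contained in the $k$-neighborhood of $H$. $H$ is stable if for every finite generating set $A$ of $G$ there exist $M$ and $k\ge0$ such that $H$ is $(M,k)$-stable in $\mathrm{Cay}(G,A)$. *)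

theory Defs
  imports "HOL-Analysis.Analysis" "HOL-Algebra.Generated_Groups"
begin

definition finite_gen_set :: "('g, 'b) monoid_scheme \<Rightarrow> 'g set \<Rightarrow> bool" where
  "finite_gen_set G A \<longleftrightarrow>
     finite A \<and> A \<subseteq> carrier G \<and> (\<lambda>a. inv\<^bsub>G\<^esub> a) ` A = A \<and> generate G A = carrier G"

definition word_elt :: "('g, 'b) monoid_scheme \<Rightarrow> 'g list \<Rightarrow> 'g" where
  "word_elt G w = foldr (\<lambda>x y. x \<otimes>\<^bsub>G\<^esub> y) w \<one>\<^bsub>G\<^esub>"


section \<open>The Cayley graph as a metric space\<close>

definition word_length :: "('g, 'b) monoid_scheme \<Rightarrow> 'g set \<Rightarrow> 'g \<Rightarrow> nat" where
  "word_length G A g = (LEAST n. \<exists>w\<in>lists A. length w = n \<and> word_elt G w = g)"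

definition word_dist :: "('g, 'b) monoid_scheme \<Rightarrow> 'g set \<Rightarrow> 'g \<Rightarrow> 'g \<Rightarrow> real" where
  "word_dist G A g h = real (word_length G A (inv\<^bsub>G\<^esub> g \<otimes>\<^bsub>G\<^esub> h))"

text \<open>
  The triple \<open>(u, v, t)\<close> denotes the point at distance \<open>t\<close> from \<open>u\<close> along the edge joining
  \<open>u\<close> and \<open>v\<close>, and \<open>(u, u, 0)\<close> denotes the vertex \<open>u\<close> (also if there is no edge at all).
  Different triples may denote the same point: \<open>(u, v, t)\<close> and \<open>(v, u, 1 - t)\<close> lie on one and the
  same edge. If the identity belongs to \<open>A\<close>, there is a loop of length 1 at every vertex.
\<close>

definition cay_triples :: "('g, 'b) monoid_scheme \<Rightarrow> 'g set \<Rightarrow> ('g \<times> 'g \<times> real) set" where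
  "cay_triples G A = {(u, v, t). u \<in> carrier G \<and> v \<in> carrier G \<and> 0 \<le> t \<and> t \<le> 1 \<and>
     (inv\<^bsub>G\<^esub> u \<otimes>\<^bsub>G\<^esub> v \<in> A \<or> u = v \<and> t = 0)}"

text \<open>
  The length of a shortest path between two points: it either stays inside one edge
  (\<open>edge_lengths\<close>), or leaves the edge of the first point through an end of that edge and enters
  the edge of the second point through an end of the latter; \<open>ends x\<close> lists the ends together with
  their distances from \<open>x\<close> along the edge. A loop must not be reversed, as \<open>(u, u, t)\<close> and
  \<open>(u, u, 1 - t)\<close> are different points of it.
\<close>

fun ends :: "'g \<times> 'g \<times> real \<Rightarrow> ('g \<times> real) set" where
  "ends (u, v, t) = {(u, t), (v, 1 - t)}"

fun edge_lengths :: "'g \<times> 'g \<times> real \<Rightarrow> 'g \<times> 'g \<times> real \<Rightarrow> real set" where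
  "edge_lengths (u, v, t) (u', v', t') =
     (if u = u' \<and> v = v' then {\<bar>t - t'\<bar>}
      else if u = v' \<and> v = u' then {\<bar>t - (1 - t')\<bar>}
      else {})"

definition triple_dist ::
    "('g, 'b) monoid_scheme \<Rightarrow> 'g set \<Rightarrow> 'g \<times> 'g \<times> real \<Rightarrow> 'g \<times> 'g \<times> real \<Rightarrow> real" where
  "triple_dist G A x y =
     Min (edge_lengths x y \<union>
          (\<lambda>((p, r), (q, s)). r + word_dist G A p q + s) ` (ends x \<times> ends y))"

text \<open>The Cayley graph is the metric quotient of this pseudometric space.\<close>

definition cay_rel :: "('g, 'b) monoid_scheme \<Rightarrow> 'g set \<Rightarrow> (('g \<times> 'g \<times> real) \<times> ('g \<times> 'g \<times> real)) set" where
  "cay_rel G A = {(x, y). x \<in> cay_triples G A \<and> y \<in> cay_triples G A \<and> triple_dist G A x y = 0}"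

type_synonym 'g cay_point = "('g \<times> 'g \<times> real) set"

definition cay_dist :: "('g, 'b) monoid_scheme \<Rightarrow> 'g set \<Rightarrow> 'g cay_point \<Rightarrow> 'g cay_point \<Rightarrow> real" where
  "cay_dist G A P Q =
     (if P \<in> cay_triples G A // cay_rel G A \<and> Q \<in> cay_triples G A // cay_rel G A
      then triple_dist G A (SOME x. x \<in> P) (SOME y. y \<in> Q) else 0)"

definition Cay :: "('g, 'b) monoid_scheme \<Rightarrow> 'g set \<Rightarrow> 'g cay_point metric" where
  "Cay G A = metric (cay_triples G A // cay_rel G A, cay_dist G A)"

definition cay_point :: "('g, 'b) monoid_scheme \<Rightarrow> 'g set \<Rightarrow> 'g \<times> 'g \<times> real \<Rightarrow> 'g cay_point" where
  "cay_point G A x = cay_rel G A `` {x}"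

definition cay_vertex :: "('g, 'b) monoid_scheme \<Rightarrow> 'g set \<Rightarrow> 'g \<Rightarrow> 'g cay_point" where
  "cay_vertex G A g = cay_point G A (g, g, 0)"

text \<open>The path on \<open>[0, length w]\<close> that starts at the identity and reads the word \<open>w\<close>.\<close>

definition word_path :: "('g, 'b) monoid_scheme \<Rightarrow> 'g set \<Rightarrow> 'g list \<Rightarrow> real \<Rightarrow> 'g cay_point" where
  "word_path G A w t =
     (let n = nat \<lfloor>t\<rfloor> in
      if n < length w
      then cay_point G A (word_elt G (take n w), word_elt G (take (Suc n) w), t - real n)
      else cay_vertex G A (word_elt G w))"


subsection \<open>The Cayley graph is a metric space\<close>

lemma word_elt_simps [simp]:
  "word_elt G [] = \<one>\<^bsub>G\<^esub>" "word_elt G (a # w) = a \<otimes>\<^bsub>G\<^esub> word_elt G w"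
  by (auto simp: word_elt_def)

lemma word_dist_nonneg [simp]: "0 \<le> word_dist G A g h"
  by (simp add: word_dist_def)

context
  fixes G :: "('g, 'b) monoid_scheme" and A :: "'g set"
  assumes G: "group G" and A: "finite_gen_set G A"
begin

interpretation group G by (rule G)

lemma gen_set:
  "finite A" "A \<subseteq> carrier G" "\<And>a. a \<in> A \<Longrightarrow> inv\<^bsub>G\<^esub> a \<in> A" "generate G A = carrier G"
  using A unfolding finite_gen_set_def by auto

lemma word_elt_closed: "w \<in> lists A \<Longrightarrow> word_elt G w \<in> carrier G"
  using gen_set(2) by (induction w) auto

lemma word_elt_append:
  "v \<in> lists A \<Longrightarrow> w \<in> lists A \<Longrightarrow> word_elt G (v @ w) = word_elt G v \<otimes>\<^bsub>G\<^esub> word_elt G w"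
proof (induction v)
  case (Cons a v)
  then have "a \<in> carrier G" "word_elt G v \<in> carrier G" "word_elt G w \<in> carrier G"
    using gen_set(2) word_elt_closed by auto
  then show ?case using Cons by (simp add: m_assoc)
qed (simp add: word_elt_closed)

lemma word_elt_inv:
  "w \<in> lists A \<Longrightarrow> rev (map (\<lambda>a. inv\<^bsub>G\<^esub> a) w) \<in> lists A \<and>
     word_elt G (rev (map (\<lambda>a. inv\<^bsub>G\<^esub> a) w)) = inv\<^bsub>G\<^esub> (word_elt G w)"
proof (induction w)
  case (Cons a w)
  then have "a \<in> carrier G" "inv\<^bsub>G\<^esub> a \<in> A" using gen_set by auto
  then show ?case
    using Cons word_elt_closed[of w] by (auto simp: word_elt_append inv_mult_group)
qed auto

lemma ex_word: "g \<in> carrier G \<Longrightarrow> \<exists>w\<in>lists A. word_elt G w = g"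
  unfolding gen_set(4)[symmetric]
proof (induction rule: generate.induct)
  case one then show ?case by (intro bexI[of _ "[]"]) auto
next
  case (incl h) then show ?case using gen_set(2) by (intro bexI[of _ "[h]"]) auto
next
  case (inv h) then show ?case using gen_set(2,3) by (intro bexI[of _ "[inv\<^bsub>G\<^esub> h]"]) auto
next
  case (eng h1 h2) then show ?case by (metis append_in_lists_conv word_elt_append)
qed

lemma word_length_le: "w \<in> lists A \<Longrightarrow> word_length G A (word_elt G w) \<le> length w"
  unfolding word_length_def by (rule Least_le) auto

lemma word_length_word:
  assumes "g \<in> carrier G"
  obtains w where "w \<in> lists A" "length w = word_length G A g" "word_elt G w = g"
proof -
  have "\<exists>n. \<exists>w\<in>lists A. length w = n \<and> word_elt G w = g" using ex_word[OF assms] by auto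
  from LeastI_ex[OF this] show ?thesis using that unfolding word_length_def by auto
qed

lemma word_dist_refl [simp]: "g \<in> carrier G \<Longrightarrow> word_dist G A g g = 0"
  using word_length_le[of "[]"] by (simp add: word_dist_def)

lemma word_dist_commute:
  assumes "g \<in> carrier G" "h \<in> carrier G"
  shows "word_dist G A g h = word_dist G A h g"
proof -
  have *: "word_length G A (inv\<^bsub>G\<^esub> x) \<le> word_length G A x" if x: "x \<in> carrier G" for x
    using word_length_word[OF x] word_elt_inv word_length_le
    by (metis length_map length_rev)
  have "inv\<^bsub>G\<^esub> (inv\<^bsub>G\<^esub> g \<otimes>\<^bsub>G\<^esub> h) = inv\<^bsub>G\<^esub> h \<otimes>\<^bsub>G\<^esub> g"
       "inv\<^bsub>G\<^esub> (inv\<^bsub>G\<^esub> h \<otimes>\<^bsub>G\<^esub> g) = inv\<^bsub>G\<^esub> g \<otimes>\<^bsub>G\<^esub> h"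
    using assms by (simp_all add: inv_mult_group)
  then show ?thesis
    using *[of "inv\<^bsub>G\<^esub> g \<otimes>\<^bsub>G\<^esub> h"] *[of "inv\<^bsub>G\<^esub> h \<otimes>\<^bsub>G\<^esub> g"] assms by (simp add: word_dist_def)
qed

lemma word_dist_triangle:
  assumes "f \<in> carrier G" "g \<in> carrier G" "h \<in> carrier G"
  shows "word_dist G A f h \<le> word_dist G A f g + word_dist G A g h"
proof -
  obtain v where v: "v \<in> lists A" "length v = word_length G A (inv\<^bsub>G\<^esub> f \<otimes>\<^bsub>G\<^esub> g)"
    "word_elt G v = inv\<^bsub>G\<^esub> f \<otimes>\<^bsub>G\<^esub> g" using assms word_length_word by (metis inv_closed m_closed)
  obtain w where w: "w \<in> lists A" "length w = word_length G A (inv\<^bsub>G\<^esub> g \<otimes>\<^bsub>G\<^esub> h)"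
    "word_elt G w = inv\<^bsub>G\<^esub> g \<otimes>\<^bsub>G\<^esub> h" using assms word_length_word by (metis inv_closed m_closed)
  have "g \<otimes>\<^bsub>G\<^esub> (inv\<^bsub>G\<^esub> g \<otimes>\<^bsub>G\<^esub> h) = h"
    using assms by (simp flip: m_assoc)
  then have "word_elt G (v @ w) = inv\<^bsub>G\<^esub> f \<otimes>\<^bsub>G\<^esub> h"
    using v w assms by (simp add: word_elt_append m_assoc)
  then have "word_length G A (inv\<^bsub>G\<^esub> f \<otimes>\<^bsub>G\<^esub> h) \<le> length (v @ w)"
    using word_length_le[of "v @ w"] v w by auto
  then show ?thesis using v w by (simp add: word_dist_def flip: of_nat_add)
qed

lemma word_dist_edge: "inv\<^bsub>G\<^esub> u \<otimes>\<^bsub>G\<^esub> v \<in> A \<Longrightarrow> word_dist G A u v \<le> 1"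
  using word_length_le[of "[inv\<^bsub>G\<^esub> u \<otimes>\<^bsub>G\<^esub> v]"] gen_set(2)
  by (auto simp: word_dist_def subset_iff)

lemma triple_dist_cases:
  obtains "triple_dist G A x y \<in> edge_lengths x y"
  | p r q s where "(p, r) \<in> ends x" "(q, s) \<in> ends y"
      "triple_dist G A x y = r + word_dist G A p q + s"
proof -
  let ?S = "edge_lengths x y \<union>
    (\<lambda>((p, r), (q, s)). r + word_dist G A p q + s) ` (ends x \<times> ends y)"
  have "finite ?S" "?S \<noteq> {}" by (cases x; cases y; auto)+
  from Min_in[OF this] show ?thesis using that unfolding triple_dist_def by fastforce
qed

lemma triple_dist_le:
  "l \<in> edge_lengths x y \<Longrightarrow> triple_dist G A x y \<le> l"
  "(p, r) \<in> ends x \<Longrightarrow> (q, s) \<in> ends y \<Longrightarrow> triple_dist G A x y \<le> r + word_dist G A p q + s"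
proof -
  let ?S = "edge_lengths x y \<union>
    (\<lambda>((p, r), (q, s)). r + word_dist G A p q + s) ` (ends x \<times> ends y)"
  have fin: "finite ?S" by (cases x; cases y; auto)
  show "l \<in> edge_lengths x y \<Longrightarrow> triple_dist G A x y \<le> l"
    unfolding triple_dist_def by (rule Min_le[OF fin]) auto
  show "(p, r) \<in> ends x \<Longrightarrow> (q, s) \<in> ends y \<Longrightarrow> triple_dist G A x y \<le> r + word_dist G A p q + s"
    unfolding triple_dist_def by (rule Min_le[OF fin]) force
qed

lemma ends_carrier: "x \<in> cay_triples G A \<Longrightarrow> (p, r) \<in> ends x \<Longrightarrow> p \<in> carrier G \<and> 0 \<le> r"
  by (auto simp: cay_triples_def)

lemma edge_lengths_cases:
  assumes "l \<in> edge_lengths (u, v, t) (u', v', t')"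
  obtains "u' = u" "v' = v" "l = \<bar>t - t'\<bar>" | "u' = v" "v' = u" "u \<noteq> v" "l = \<bar>t - (1 - t')\<bar>"
proof (cases "u = u' \<and> v = v'")
  case True
  then show ?thesis using assms that(1) by simp
next
  case False
  then have "u = v' \<and> v = u'" "l \<in> (if u = v' \<and> v = u' then {\<bar>t - (1 - t')\<bar>} else {})"
    using assms unfolding edge_lengths.simps by (metis empty_iff)+
  then show ?thesis using False that(2) by (metis singletonD)
qed

lemma edge_lengths_nonneg: "l \<in> edge_lengths x y \<Longrightarrow> 0 \<le> l"
  by (cases x, cases y, hypsubst, erule edge_lengths_cases) (simp_all only: abs_ge_zero)

lemma edge_lengths_commute: "edge_lengths x y = edge_lengths y x"
proof -
  obtain u v t where x: "x = (u, v, t)" by (cases x)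
  obtain u' v' t' where y: "y = (u', v', t')" by (cases y)
  have "\<bar>t - t'\<bar> = \<bar>t' - t\<bar>" "\<bar>t - (1 - t')\<bar> = \<bar>t' - (1 - t)\<bar>" by linarith+
  moreover have "(u = u' \<and> v = v') = (u' = u \<and> v' = v)" "(u = v' \<and> v = u') = (u' = v \<and> v' = u)"
    by blast+
  ultimately show ?thesis unfolding x y edge_lengths.simps by presburger
qed

lemma ends_word_dist:
  assumes "x \<in> cay_triples G A" "(p, r) \<in> ends x" "(q, s) \<in> ends x"
  shows "word_dist G A p q \<le> r + s"
proof -
  obtain u v t where x: "x = (u, v, t)" by (cases x)
  have "u \<in> carrier G" "v \<in> carrier G" "word_dist G A u v \<le> 1" "0 \<le> t" "t \<le> 1"
    using assms(1) word_dist_edge[of u v] by (auto simp: x cay_triples_def)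
  then show ?thesis using assms(2,3) by (auto simp: x word_dist_commute[of v u])
qed

lemma ends_edge_lengths:
  assumes "l \<in> edge_lengths x y" "(p, s) \<in> ends y"
  shows "\<exists>r. (p, r) \<in> ends x \<and> r \<le> l + s"
proof -
  obtain u v t u' v' t' where x: "x = (u, v, t)" and y: "y = (u', v', t')" by (cases x; cases y)
  have p: "(p = u' \<and> s = t') \<or> (p = v' \<and> s = 1 - t')" using assms(2) by (simp add: y)
  have ends: "(u, t) \<in> ends x" "(v, 1 - t) \<in> ends x" by (simp_all add: x)
  show ?thesis
  proof (rule edge_lengths_cases[OF assms(1)[unfolded x y]])
    assume *: "u' = u" "v' = v" "l = \<bar>t - t'\<bar>"
    have "t \<le> l + t'" "1 - t \<le> l + (1 - t')" unfolding *(3) by linarith+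
    then show ?thesis using p ends *(1,2) by blast
  next
    assume *: "u' = v" "v' = u" "l = \<bar>t - (1 - t')\<bar>"
    have "t \<le> l + (1 - t')" "1 - t \<le> l + t'" unfolding *(3) by linarith+
    then show ?thesis using p ends *(1,2) by blast
  qed
qed

lemma edge_lengths_trans:
  assumes "l \<in> edge_lengths x y" "m \<in> edge_lengths y z"
  shows "\<exists>n\<in>edge_lengths x z. n \<le> l + m"
proof -
  obtain u v t where x: "x = (u, v, t)" by (cases x)
  obtain u' v' t' where y: "y = (u', v', t')" by (cases y)
  obtain u'' v'' t'' where z: "z = (u'', v'', t'')" by (cases z)
  have direct: "\<bar>t - t''\<bar> \<in> edge_lengths x z" if "u'' = u" "v'' = v"
    by (simp add: x z that)
  have flipped: "\<bar>t - (1 - t'')\<bar> \<in> edge_lengths x z" if "u'' = v" "v'' = u" "u \<noteq> v"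
    using that(3) by (simp add: x z that(1,2))
  show ?thesis
  proof (rule edge_lengths_cases[OF assms(1)[unfolded x y]];
         rule edge_lengths_cases[OF assms(2)[unfolded y z]])
    assume *: "u' = u" "v' = v" "l = \<bar>t - t'\<bar>" "u'' = u'" "v'' = v'" "m = \<bar>t' - t''\<bar>"
    have "\<bar>t - t''\<bar> \<le> l + m" unfolding * by linarith
    then show ?thesis using direct * by blast
  next
    assume *: "u' = u" "v' = v" "l = \<bar>t - t'\<bar>"
      "u'' = v'" "v'' = u'" "u' \<noteq> v'" "m = \<bar>t' - (1 - t'')\<bar>"
    have "\<bar>t - (1 - t'')\<bar> \<le> l + m" unfolding *(3,7) by linarith
    then show ?thesis using flipped * by blast
  next
    assume *: "u' = v" "v' = u" "u \<noteq> v" "l = \<bar>t - (1 - t')\<bar>"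
      "u'' = u'" "v'' = v'" "m = \<bar>t' - t''\<bar>"
    have "\<bar>t - (1 - t'')\<bar> \<le> l + m" unfolding *(4,7) by linarith
    then show ?thesis using flipped * by blast
  next
    assume *: "u' = v" "v' = u" "l = \<bar>t - (1 - t')\<bar>"
      "u'' = v'" "v'' = u'" "m = \<bar>t' - (1 - t'')\<bar>"
    have "\<bar>t - t''\<bar> \<le> l + m" unfolding *(3,6) by linarith
    then show ?thesis using direct * by blast
  qed
qed

lemma triple_dist_nonneg:
  assumes "x \<in> cay_triples G A" "y \<in> cay_triples G A"
  shows "0 \<le> triple_dist G A x y"
proof (rule triple_dist_cases[of x y])
  fix p r q s
  assume *: "(p, r) \<in> ends x" "(q, s) \<in> ends y" "triple_dist G A x y = r + word_dist G A p q + s"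
  then have "0 \<le> r" "0 \<le> s" using assms ends_carrier by blast+
  then show ?thesis using * by simp
qed (rule edge_lengths_nonneg)

lemma triple_dist_refl:
  assumes "x \<in> cay_triples G A"
  shows "triple_dist G A x x = 0"
proof -
  have "0 \<in> edge_lengths x x" by (cases x) auto
  then show ?thesis using triple_dist_le(1)[of 0 x x] triple_dist_nonneg[OF assms assms] by simp
qed

lemma triple_dist_commute_le:
  assumes "x \<in> cay_triples G A" "y \<in> cay_triples G A"
  shows "triple_dist G A x y \<le> triple_dist G A y x"
proof (rule triple_dist_cases[of y x])
  assume "triple_dist G A y x \<in> edge_lengths y x"
  then show ?thesis using triple_dist_le(1)[of _ x y] edge_lengths_commute[of x y] by metis
next
  fix p r q s assume *: "(p, r) \<in> ends y" "(q, s) \<in> ends x"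
    "triple_dist G A y x = r + word_dist G A p q + s"
  have "word_dist G A p q = word_dist G A q p"
    using word_dist_commute ends_carrier[OF assms(1) *(2)] ends_carrier[OF assms(2) *(1)] by blast
  then show ?thesis using triple_dist_le(2)[OF *(2,1)] *(3) by linarith
qed

lemma triple_dist_commute:
  assumes "x \<in> cay_triples G A" "y \<in> cay_triples G A"
  shows "triple_dist G A x y = triple_dist G A y x"
  by (rule order_antisym[OF triple_dist_commute_le[OF assms] triple_dist_commute_le[OF assms(2,1)]])

lemma triple_dist_triangle:
  assumes "x \<in> cay_triples G A" "y \<in> cay_triples G A" "z \<in> cay_triples G A"
  shows "triple_dist G A x z \<le> triple_dist G A x y + triple_dist G A y z"
proof (rule triple_dist_cases[of x y]; rule triple_dist_cases[of y z])
  assume "triple_dist G A x y \<in> edge_lengths x y" "triple_dist G A y z \<in> edge_lengths y z"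
  from edge_lengths_trans[OF this]
  obtain n where "n \<in> edge_lengths x z" "n \<le> triple_dist G A x y + triple_dist G A y z" ..
  then show ?thesis using triple_dist_le(1)[of n x z] by simp
next
  fix p r q s assume *: "triple_dist G A x y \<in> edge_lengths x y"
    "(p, r) \<in> ends y" "(q, s) \<in> ends z" "triple_dist G A y z = r + word_dist G A p q + s"
  obtain r' where "(p, r') \<in> ends x" "r' \<le> triple_dist G A x y + r"
    using ends_edge_lengths[OF *(1,2)] by (elim exE conjE)
  then show ?thesis using triple_dist_le(2)[of p r' x q s z] *(3,4) by simp
next
  fix p r q s assume *: "triple_dist G A y z \<in> edge_lengths y z"
    "(p, r) \<in> ends x" "(q, s) \<in> ends y" "triple_dist G A x y = r + word_dist G A p q + s"
  obtain s' where "(q, s') \<in> ends z" "s' \<le> triple_dist G A y z + s"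
    using ends_edge_lengths[OF *(1)[unfolded edge_lengths_commute[of y z]] *(3)] by (elim exE conjE)
  then show ?thesis using triple_dist_le(2)[of p r x q s' z] *(2,4) by simp
next
  fix p r q s p' r' q' s'
  assume *: "(p, r) \<in> ends x" "(q, s) \<in> ends y" "triple_dist G A x y = r + word_dist G A p q + s"
    "(p', r') \<in> ends y" "(q', s') \<in> ends z" "triple_dist G A y z = r' + word_dist G A p' q' + s'"
  have c: "p \<in> carrier G" "q \<in> carrier G" "p' \<in> carrier G" "q' \<in> carrier G"
    using ends_carrier[OF assms(1) *(1)] ends_carrier[OF assms(2) *(2)]
      ends_carrier[OF assms(2) *(4)] ends_carrier[OF assms(3) *(5)] by simp_all
  have "triple_dist G A x z \<le> r + word_dist G A p q' + s'"
    by (rule triple_dist_le(2)[OF *(1,5)])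
  moreover have "word_dist G A p q' \<le> word_dist G A p q + word_dist G A q q'"
    "word_dist G A q q' \<le> word_dist G A q p' + word_dist G A p' q'"
    using c by (simp_all add: word_dist_triangle)
  moreover have "word_dist G A q p' \<le> s + r'"
    by (rule ends_word_dist[OF assms(2) *(2,4)])
  ultimately show ?thesis using *(3,6) by linarith
qed

lemma equiv_cay_rel: "equiv (cay_triples G A) (cay_rel G A)"
proof (rule equivI)
  show "trans (cay_rel G A)"
  proof (rule transI)
    fix x y z assume "(x, y) \<in> cay_rel G A" "(y, z) \<in> cay_rel G A"
    then show "(x, z) \<in> cay_rel G A"
      using triple_dist_triangle[of x y z] triple_dist_nonneg[of x z] by (auto simp: cay_rel_def)
  qed
  show "sym (cay_rel G A)"
    by (rule symI) (use triple_dist_commute in \<open>auto simp: cay_rel_def\<close>)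
qed (auto simp: cay_rel_def refl_on_def triple_dist_refl)

lemma cay_dist_eq:
  assumes "P \<in> cay_triples G A // cay_rel G A" "Q \<in> cay_triples G A // cay_rel G A" "x \<in> P" "y \<in> Q"
  shows "cay_dist G A P Q = triple_dist G A x y"
proof -
  define x' y' where "x' = (SOME x. x \<in> P)" and "y' = (SOME y. y \<in> Q)"
  have "x' \<in> P" "y' \<in> Q" unfolding x'_def y'_def using assms(3,4) by (auto intro: someI)
  then have "(x, x') \<in> cay_rel G A" "(y, y') \<in> cay_rel G A"
    using quotient_eq_iff[OF equiv_cay_rel assms(1,1,3), of x']
      quotient_eq_iff[OF equiv_cay_rel assms(2,2,4), of y'] by simp_all
  then have *: "x \<in> cay_triples G A" "x' \<in> cay_triples G A" "y \<in> cay_triples G A" "y' \<in> cay_triples G A"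
    "triple_dist G A x x' = 0" "triple_dist G A y y' = 0" by (auto simp: cay_rel_def)
  then have "triple_dist G A x' y' = triple_dist G A x y"
    using triple_dist_triangle[of x x' y] triple_dist_triangle[of x' y' y]
      triple_dist_triangle[of x' x y'] triple_dist_triangle[of x y y']
      triple_dist_commute[of x x'] triple_dist_commute[of y y'] by linarith
  then show ?thesis using assms(1,2) by (simp add: cay_dist_def x'_def y'_def)
qed

lemma cay_point_repr:
  assumes "P \<in> cay_triples G A // cay_rel G A"
  obtains x where "x \<in> P" "x \<in> cay_triples G A"
  using in_quotient_imp_non_empty[OF equiv_cay_rel assms]
    in_quotient_imp_subset[OF equiv_cay_rel assms] by fast

lemma Metric_space_Cay: "Metric_space (cay_triples G A // cay_rel G A) (cay_dist G A)"
proof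
  let ?X = "cay_triples G A // cay_rel G A"
  fix P Q
  have "0 \<le> cay_dist G A P Q \<and> cay_dist G A P Q = cay_dist G A Q P"
  proof (cases "P \<in> ?X \<and> Q \<in> ?X")
    case True
    then have PQ: "P \<in> ?X" "Q \<in> ?X" by simp_all
    obtain x where x: "x \<in> P" "x \<in> cay_triples G A" by (rule cay_point_repr[OF PQ(1)])
    obtain y where y: "y \<in> Q" "y \<in> cay_triples G A" by (rule cay_point_repr[OF PQ(2)])
    show ?thesis
      unfolding cay_dist_eq[OF PQ x(1) y(1)] cay_dist_eq[OF PQ(2,1) y(1) x(1)]
      by (intro conjI triple_dist_nonneg triple_dist_commute x(2) y(2))
  qed (auto simp: cay_dist_def)
  then show "0 \<le> cay_dist G A P Q" "cay_dist G A P Q = cay_dist G A Q P" by simp_all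
next
  let ?X = "cay_triples G A // cay_rel G A"
  fix P Q assume PQ: "P \<in> ?X" "Q \<in> ?X"
  obtain x where x: "x \<in> P" "x \<in> cay_triples G A" by (rule cay_point_repr[OF PQ(1)])
  obtain y where y: "y \<in> Q" "y \<in> cay_triples G A" by (rule cay_point_repr[OF PQ(2)])
  have "cay_dist G A P Q = 0 \<longleftrightarrow> (x, y) \<in> cay_rel G A"
    unfolding cay_dist_eq[OF PQ x(1) y(1)] using x y by (simp add: cay_rel_def)
  also have "\<dots> \<longleftrightarrow> P = Q" using quotient_eq_iff[OF equiv_cay_rel PQ x(1) y(1)] by simp
  finally show "cay_dist G A P Q = 0 \<longleftrightarrow> P = Q" .
next
  let ?X = "cay_triples G A // cay_rel G A"
  fix P Q R assume PQR: "P \<in> ?X" "Q \<in> ?X" "R \<in> ?X"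
  obtain x where x: "x \<in> P" "x \<in> cay_triples G A" by (rule cay_point_repr[OF PQR(1)])
  obtain y where y: "y \<in> Q" "y \<in> cay_triples G A" by (rule cay_point_repr[OF PQR(2)])
  obtain z where z: "z \<in> R" "z \<in> cay_triples G A" by (rule cay_point_repr[OF PQR(3)])
  show "cay_dist G A P R \<le> cay_dist G A P Q + cay_dist G A Q R"
    unfolding cay_dist_eq[OF PQR(1,2) x(1) y(1)] cay_dist_eq[OF PQR(2,3) y(1) z(1)]
      cay_dist_eq[OF PQR(1,3) x(1) z(1)]
    by (rule triple_dist_triangle[OF x(2) y(2) z(2)])
qed

lemma mspace_Cay: "mspace (Cay G A) = cay_triples G A // cay_rel G A"
  unfolding Cay_def by (rule Metric_space.mspace_metric[OF Metric_space_Cay])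

lemma mdist_Cay:
  assumes "x \<in> cay_triples G A" "y \<in> cay_triples G A"
  shows "mdist (Cay G A) (cay_point G A x) (cay_point G A y) = triple_dist G A x y"
  unfolding Cay_def Metric_space.mdist_metric[OF Metric_space_Cay]
  using assms equiv_class_self[OF equiv_cay_rel]
  by (intro cay_dist_eq) (auto simp: cay_point_def quotientI)

lemma mdist_Cay_vertices:
  assumes "g \<in> carrier G" "h \<in> carrier G"
  shows "mdist (Cay G A) (cay_vertex G A g) (cay_vertex G A h) = word_dist G A g h"
proof -
  have "(g, g, 0) \<in> cay_triples G A" "(h, h, 0) \<in> cay_triples G A"
    using assms by (auto simp: cay_triples_def)
  moreover have "triple_dist G A (g, g, 0) (h, h, 0) \<le> word_dist G A g h"
    using triple_dist_le(2)[of g 0 "(g, g, 0)" h 0 "(h, h, 0)"] by simp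
  moreover have "word_dist G A g h \<le> triple_dist G A (g, g, 0) (h, h, 0)"
    by (rule triple_dist_cases[of "(g, g, 0)" "(h, h, 0)"]) (use assms in \<open>auto split: if_splits\<close>)
  ultimately show ?thesis by (simp add: cay_vertex_def mdist_Cay)
qed

end

section \<open>Morse quasi-geodesics\<close>

definition closed_interval :: "real set \<Rightarrow> bool" where
  "closed_interval I \<longleftrightarrow> I \<noteq> {} \<and> closed I \<and> is_interval I"

definition quasi_geodesic :: "'x metric \<Rightarrow> real \<Rightarrow> real \<Rightarrow> real set \<Rightarrow> (real \<Rightarrow> 'x) \<Rightarrow> bool" where
  "quasi_geodesic X k c I \<gamma> \<longleftrightarrow>
     closed_interval I \<and> k \<ge> 1 \<and> c \<ge> 0 \<and> \<gamma> \<in> I \<rightarrow> mspace X \<and>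
     (\<forall>s\<in>I. \<forall>t\<in>I. 1 / k * \<bar>s - t\<bar> - c \<le> mdist X (\<gamma> s) (\<gamma> t) \<and>
                   mdist X (\<gamma> s) (\<gamma> t) \<le> k * \<bar>s - t\<bar> + c)"

definition geodesic :: "'x metric \<Rightarrow> real set \<Rightarrow> (real \<Rightarrow> 'x) \<Rightarrow> bool" where
  "geodesic X I \<gamma> \<longleftrightarrow> quasi_geodesic X 1 0 I \<gamma>"

definition nbhd :: "'x metric \<Rightarrow> real \<Rightarrow> 'x set \<Rightarrow> 'x set" where
  "nbhd X r S = {x \<in> mspace X. \<exists>y\<in>S. mdist X x y \<le> r}"

text \<open>Only the values at \<open>k \<ge> 1\<close> and \<open>c \<ge> 0\<close> are relevant.\<close>

definition morse_gauge :: "(real \<Rightarrow> real \<Rightarrow> real) \<Rightarrow> bool" where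
  "morse_gauge M \<longleftrightarrow> (\<forall>k\<ge>1. \<forall>c\<ge>0. M k c \<ge> 0)"

definition is_Morse :: "'x metric \<Rightarrow> (real \<Rightarrow> real \<Rightarrow> real) \<Rightarrow> real set \<Rightarrow> (real \<Rightarrow> 'x) \<Rightarrow> bool" where
  "is_Morse X M I \<gamma> \<longleftrightarrow>
     (\<forall>s t. s \<le> t \<and> {s..t} \<subseteq> I \<longrightarrow>
        (\<forall>k c a b \<eta>. a \<le> b \<and> quasi_geodesic X k c {a..b} \<eta> \<and> \<eta> a = \<gamma> s \<and> \<eta> b = \<gamma> t \<longrightarrow>
           \<eta> ` {a..b} \<subseteq> nbhd X (M k c) (\<gamma> ` {s..t})))"

definition Morse_quasi_geodesic ::
    "'x metric \<Rightarrow> (real \<Rightarrow> real \<Rightarrow> real) \<Rightarrow> real \<Rightarrow> real \<Rightarrow> real set \<Rightarrow> (real \<Rightarrow> 'x) \<Rightarrow> bool" where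
  "Morse_quasi_geodesic X M k c I \<gamma> \<longleftrightarrow> quasi_geodesic X k c I \<gamma> \<and> is_Morse X M I \<gamma>"

definition local_Morse_quasi_geodesic ::
    "'x metric \<Rightarrow> real \<Rightarrow> (real \<Rightarrow> real \<Rightarrow> real) \<Rightarrow> real \<Rightarrow> real \<Rightarrow> real set \<Rightarrow> (real \<Rightarrow> 'x) \<Rightarrow> bool" where
  "local_Morse_quasi_geodesic X B M k c I \<gamma> \<longleftrightarrow>
     closed_interval I \<and> \<gamma> \<in> I \<rightarrow> mspace X \<and>
     (\<forall>s t. s \<le> t \<and> {s..t} \<subseteq> I \<and> \<bar>s - t\<bar> \<le> B \<longrightarrow> Morse_quasi_geodesic X M k c {s..t} \<gamma>)"

definition Morse_local_to_global_space :: "'x metric \<Rightarrow> bool" where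
  "Morse_local_to_global_space X \<longleftrightarrow>
     (\<forall>M k c. morse_gauge M \<and> k \<ge> 1 \<and> c \<ge> 0 \<longrightarrow>
        (\<exists>B M' k' c'. B \<ge> 0 \<and> morse_gauge M' \<and> k' \<ge> 1 \<and> c' \<ge> 0 \<and>
           (\<forall>I \<gamma>. local_Morse_quasi_geodesic X B M k c I \<gamma> \<longrightarrow>
                  Morse_quasi_geodesic X M' k' c' I \<gamma>)))"

definition Morse_local_to_global_group :: "('g, 'b) monoid_scheme \<Rightarrow> bool" where
  "Morse_local_to_global_group G \<longleftrightarrow>
     group G \<and> (\<exists>A. finite_gen_set G A \<and> Morse_local_to_global_space (Cay G A))"


section \<open>Stable subgroups\<close>

definition stable_in ::
    "('g, 'b) monoid_scheme \<Rightarrow> 'g set \<Rightarrow> (real \<Rightarrow> real \<Rightarrow> real) \<Rightarrow> real \<Rightarrow> 'g set \<Rightarrow> bool" where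
  "stable_in G A M k H \<longleftrightarrow>
     (\<forall>h\<in>H. \<forall>a b \<gamma>. a \<le> b \<and> geodesic (Cay G A) {a..b} \<gamma> \<and>
        \<gamma> a = cay_vertex G A \<one>\<^bsub>G\<^esub> \<and> \<gamma> b = cay_vertex G A h \<longrightarrow>
        is_Morse (Cay G A) M {a..b} \<gamma> \<and>
        \<gamma> ` {a..b} \<subseteq> nbhd (Cay G A) k (cay_vertex G A ` H))"

definition stable_subgroup :: "('g, 'b) monoid_scheme \<Rightarrow> 'g set \<Rightarrow> bool" where
  "stable_subgroup G H \<longleftrightarrow>
     (\<forall>A. finite_gen_set G A \<longrightarrow> (\<exists>M k. morse_gauge M \<and> k \<ge> 0 \<and> stable_in G A M k H))"


section \<open>Languages\<close>

text \<open>
  A language over the alphabet \<open>A\<close> is regular if it is accepted by a deterministic finite automaton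
  with state set \<open>Q\<close>, initial state \<open>q0\<close>, accepting states \<open>F\<close> and transition function \<open>\<delta>\<close>.
  Up to renaming, the finitely many states are natural numbers.
\<close>

definition regular_language :: "'a set \<Rightarrow> 'a list set \<Rightarrow> bool" where
  "regular_language A L \<longleftrightarrow>
     (\<exists>(Q :: nat set) q0 F \<delta>. finite Q \<and> q0 \<in> Q \<and> F \<subseteq> Q \<and> (\<forall>q\<in>Q. \<forall>a\<in>A. \<delta> q a \<in> Q) \<and>
        L = {w \<in> lists A. foldl \<delta> q0 w \<in> F})"

definition geodesic_word :: "('g, 'b) monoid_scheme \<Rightarrow> 'g set \<Rightarrow> 'g list \<Rightarrow> bool" where
  "geodesic_word G A w \<longleftrightarrow>
     w \<in> lists A \<and> geodesic (Cay G A) {0..real (length w)} (word_path G A w)"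

definition Morse_geodesic_word ::
    "('g, 'b) monoid_scheme \<Rightarrow> 'g set \<Rightarrow> (real \<Rightarrow> real \<Rightarrow> real) \<Rightarrow> 'g list \<Rightarrow> bool" where
  "Morse_geodesic_word G A M w \<longleftrightarrow>
     geodesic_word G A w \<and> is_Morse (Cay G A) M {0..real (length w)} (word_path G A w)"

definition geodesic_language :: "('g, 'b) monoid_scheme \<Rightarrow> 'g set \<Rightarrow> 'g set \<Rightarrow> 'g list set" where
  "geodesic_language G A H = {w. geodesic_word G A w \<and> word_elt G w \<in> H}"

end

theory Submission
  imports Defs
begin

text \<open>
  Write \<open>|g|\<close> for the word length of \<open>g\<close> and \<open>L\<close> for the language of geodesic words that represent
  elements of \<open>H\<close>. The fact behind everything is that a quasi-geodesic whose ends lie near the ends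
  of a Morse geodesic stays near it. As quasi-geodesics may jump, it can be applied to maps into the
  vertex set, and replacing the values at the two ends only changes the additive constant
  (\<open>Morse_word_vertices\<close>).

  Let \<open>H\<close> be stable. A language is regular if finitely many data determine its residuals
  (\<open>regular_language_if_finite_index\<close>). For a prefix of a word of \<open>L\<close>, ending at \<open>g\<close>, the data are the set of
  all \<open>x\<close> in a ball with \<open>g x\<^sup>-\<^sup>1 \<in> H\<close>, and the function \<open>x \<mapsto> |g x| - |g|\<close> on a ball; this is Cannon's
  argument for hyperbolic groups. Suppose that \<open>w\<close> and \<open>w'\<close> have the same data, end at \<open>g\<close> and \<open>g'\<close>, and
  that \<open>w u \<in> L\<close>. As these prefixes end near \<open>H\<close>, the first datum is not empty, so
  \<open>T = g' g\<^sup>-\<^sup>1 \<in> H\<close>, and left multiplication by \<open>T\<close> carries the path \<open>u\<close> from \<open>g\<close> to the path \<open>u\<close> from \<open>g'\<close>.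
  Hence \<open>w' u\<close> ends in \<open>H\<close>, and all its vertices after \<open>g'\<close> are as close to \<open>H\<close> as those of \<open>w u\<close>. Let
  \<open>v\<close> be a prefix of \<open>u\<close> such that \<open>w' v\<close> without its last letter is geodesic, and compare \<open>w' v\<close> with a
  geodesic \<open>z\<close> that has the same endpoint. Both follow a Morse geodesic with endpoint in \<open>H\<close>, so \<open>z\<close>
  passes near \<open>g'\<close>, through \<open>g' x\<close> say. If \<open>z\<close> were shorter than \<open>w' v\<close>, then, by the second datum,
  the path through \<open>g x\<close> would be a shortcut to the endpoint of the geodesic word \<open>w v\<close>
  (\<open>continuation_transfer\<close>).

  The words that are lexicographically least among all words of \<open>L\<close> with the same endpoint represent
  every element of \<open>H\<close> once. Two words of \<open>L\<close> with the same endpoint stay close to each other, hence it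
  suffices to add as a third datum the set of all \<open>x\<close> in a ball such that \<open>g x\<close> is the endpoint of a word
  smaller than \<open>w\<close> (\<open>regular_lex_least_language\<close>).

  Conversely, let \<open>L\<close> be regular with uniformly Morse words. If an accepting state can be reached from
  a state of the automaton, then in boundedly many steps; so prefixes of words of \<open>L\<close> end near \<open>H\<close>.
  Stability asks for Morse geodesics with respect to every finite generating set \<open>B\<close>. The vertices
  along a geodesic of the Cayley graph of \<open>B\<close> from the identity to \<open>H\<close> form a quasi-geodesic for \<open>A\<close>,
  which therefore follows a word of \<open>L\<close>, and it inherits the Morse property from this word
  (\<open>stable_in_if_Morse_words\<close>).
\<close>

section \<open>Regular languages and residuals\<close>

text \<open>
  The Myhill--Nerode argument: the states of the automaton are the residuals, of which there are at
  most as many as values of \<open>f\<close>. Only a sufficient condition on residuals is asked of \<open>f\<close>, so that it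
  may record more about a word than is necessary.
\<close>

lemma regular_language_if_finite_index:
  fixes f :: "'a list \<Rightarrow> 'c"
  assumes L: "L \<subseteq> lists A" and fin: "finite (f ` lists A)"
    and f: "\<And>w w' u. w \<in> lists A \<Longrightarrow> w' \<in> lists A \<Longrightarrow> u \<in> lists A \<Longrightarrow> f w = f w' \<Longrightarrow>
      w @ u \<in> L \<Longrightarrow> w' @ u \<in> L"
  shows "regular_language A L"
proof -
  define res where "res w = {u \<in> lists A. w @ u \<in> L}" for w
  define R where "R = res ` lists A"
  have res_f: "res w = res w'" if "w \<in> lists A" "w' \<in> lists A" "f w = f w'" for w w'
    using f[OF that(1,2)] f[OF that(2,1)] that(3) by (auto simp: res_def)
  have "R = (\<lambda>y. res (SOME w. w \<in> lists A \<and> f w = y)) ` (f ` lists A)"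
  proof -
    have "res (SOME v. v \<in> lists A \<and> f v = f w) = res w" if "w \<in> lists A" for w
    proof -
      have "\<exists>v. v \<in> lists A \<and> f v = f w" using that by blast
      from someI_ex[OF this] show ?thesis using res_f[OF _ that] by presburger
    qed
    then show ?thesis unfolding R_def image_image by (intro image_cong) auto
  qed
  then have "finite R" using fin by simp
  \<comment> \<open>The states have to be natural numbers, so the residuals are numbered.\<close>
  then obtain idx :: "'a list set \<Rightarrow> nat" where inj: "inj_on idx R"
    using finite_imp_inj_to_nat_seg by blast
  define \<delta> where "\<delta> q a = idx {u \<in> lists A. a # u \<in> inv_into R idx q}" for q a
  have res_R: "res w \<in> R" if "w \<in> lists A" for w using that by (simp add: R_def)
  have step: "\<delta> (idx (res w)) a = idx (res (w @ [a]))" if "w \<in> lists A" "a \<in> A" for w a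
  proof -
    have "{u \<in> lists A. a # u \<in> res w} = res (w @ [a])"
      using that by (auto simp: res_def)
    then show ?thesis unfolding \<delta>_def inv_into_f_f[OF inj res_R[OF that(1)]] by simp
  qed
  have run: "foldl \<delta> (idx (res v)) w = idx (res (v @ w))" if "v \<in> lists A" "w \<in> lists A" for v w
    using that
  proof (induction w arbitrary: v)
    case (Cons a w)
    then show ?case using step[of v a] Cons.IH[of "v @ [a]"] by simp
  qed simp
  define F where "F = idx ` {S \<in> R. [] \<in> S}"
  have accept: "foldl \<delta> (idx (res [])) w \<in> F \<longleftrightarrow> w \<in> L" if "w \<in> lists A" for w
  proof -
    have "foldl \<delta> (idx (res [])) w \<in> F \<longleftrightarrow> [] \<in> res w"
      using run[of "[]" w] that inj_on_image_mem_iff[OF inj, of "res w" "{S \<in> R. [] \<in> S}"] res_R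
      by (auto simp: F_def)
    then show ?thesis by (simp add: res_def)
  qed
  show ?thesis
    unfolding regular_language_def
  proof (intro exI conjI ballI)
    show "finite (idx ` R)" using \<open>finite R\<close> by simp
    show "idx (res []) \<in> idx ` R" using res_R by simp
    show "F \<subseteq> idx ` R" by (auto simp: F_def)
    show "\<delta> q a \<in> idx ` R" if "q \<in> idx ` R" "a \<in> A" for q a
    proof -
      obtain w where w: "w \<in> lists A" "q = idx (res w)" using \<open>q \<in> idx ` R\<close> unfolding R_def by blast
      then have "\<delta> q a = idx (res (w @ [a]))" using step \<open>a \<in> A\<close> by simp
      then show ?thesis using res_R[of "w @ [a]"] w(1) \<open>a \<in> A\<close> by simp
    qed
    show "L = {w \<in> lists A. foldl \<delta> (idx (res [])) w \<in> F}" using accept L by blast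
  qed
qed

text \<open>
  For each of the finitely many states from which an accepting state can be reached, fix one word
  that leads there; \<open>C\<close> is the greatest length of these words.
\<close>

lemma regular_language_completion_bound:
  assumes "regular_language A L"
  obtains C where "\<And>w i. w \<in> L \<Longrightarrow> \<exists>u\<in>lists A. length u \<le> C \<and> take i w @ u \<in> L"
proof -
  obtain Q :: "nat set" and q0 F \<delta> where Q: "finite Q" "q0 \<in> Q" "\<forall>q\<in>Q. \<forall>a\<in>A. \<delta> q a \<in> Q"
    and L: "L = {w \<in> lists A. foldl \<delta> q0 w \<in> F}"
    using assms unfolding regular_language_def by blast
  have run: "foldl \<delta> q w \<in> Q" if "q \<in> Q" "w \<in> lists A" for q w
    using that Q(3) by (induction w arbitrary: q) auto
  define e where "e q = (SOME u. u \<in> lists A \<and> foldl \<delta> q u \<in> F)" for q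
  define C where "C = Max ((length \<circ> e) ` Q)"
  show ?thesis
  proof (rule that)
    fix w i assume w: "w \<in> L"
    define q where "q = foldl \<delta> q0 (take i w)"
    have wA: "take i w \<in> lists A" "drop i w \<in> lists A"
      using w unfolding L by (auto dest: in_set_takeD in_set_dropD)
    have q: "q \<in> Q" unfolding q_def by (rule run[OF Q(2) wA(1)])
    have "foldl \<delta> q (drop i w) = foldl \<delta> q0 w"
      unfolding q_def foldl_append[symmetric] by simp
    then have "foldl \<delta> q (drop i w) \<in> F" using w unfolding L by simp
    then have e: "e q \<in> lists A \<and> foldl \<delta> q (e q) \<in> F"
      using someI[of "\<lambda>u. u \<in> lists A \<and> foldl \<delta> q u \<in> F" "drop i w"] wA(2)
      unfolding e_def by (simp del: in_lists_conv_set)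
    moreover have "length (e q) \<le> C" unfolding C_def using Q(1) q by (intro Max_ge) auto
    ultimately show "\<exists>u\<in>lists A. length u \<le> C \<and> take i w @ u \<in> L"
      using wA(1) unfolding L q_def by (intro bexI[of _ "e q"]) (auto simp: q_def)
  qed
qed

section \<open>The lexicographic order on words of equal length\<close>

lemma lex_total_on:
  assumes "total_on A r" "length xs = length ys" "xs \<in> lists A" "ys \<in> lists A"
  shows "xs = ys \<or> (xs, ys) \<in> lex r \<or> (ys, xs) \<in> lex r"
  using assms(2,3,4)
proof (induction xs ys rule: list_induct2)
  case (Cons x xs y ys)
  then have "x = y \<or> (x, y) \<in> r \<or> (y, x) \<in> r" using assms(1) by (auto simp: total_on_def)
  then show ?case using Cons by auto
qed simp

lemma lex_append_cases:
  "length xs = length ys \<Longrightarrow> (xs @ us, ys @ vs) \<in> lex r \<Longrightarrow>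
    (xs, ys) \<in> lex r \<or> xs = ys \<and> (us, vs) \<in> lex r"
  by (induction xs ys rule: list_induct2) auto

lemma lex_length: "(xs, ys) \<in> lex r \<Longrightarrow> length xs = length ys"
  by (simp add: lex_conv)

section \<open>Vertices of the Cayley graph\<close>

lemma quasi_geodesicD:
  assumes "quasi_geodesic X k c I \<gamma>" "s \<in> I" "t \<in> I"
  shows "\<gamma> s \<in> mspace X" "1 / k * \<bar>s - t\<bar> - c \<le> mdist X (\<gamma> s) (\<gamma> t)"
    "mdist X (\<gamma> s) (\<gamma> t) \<le> k * \<bar>s - t\<bar> + c"
  using assms unfolding quasi_geodesic_def by blast+

locale cayley = group G for G :: "('g, 'b) monoid_scheme" (structure) +
  fixes A :: "'g set"
  assumes gen: "finite_gen_set G A"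
begin

text \<open>
  \<open>vertex w i\<close> is the vertex after \<open>i\<close> steps along \<open>w\<close>; for \<open>i > length w\<close> it is the endpoint of \<open>w\<close>,
  which makes it possible to compare words of different lengths step by step.
\<close>

abbreviation d :: "'g \<Rightarrow> 'g \<Rightarrow> real" where "d \<equiv> word_dist G A"
abbreviation vertex :: "'g list \<Rightarrow> nat \<Rightarrow> 'g" where "vertex w i \<equiv> word_elt G (take i w)"

lemmas elt_closed [simp] = word_elt_closed[OF group_axioms gen]
lemmas elt_append = word_elt_append[OF group_axioms gen]
lemmas d_refl [simp] = word_dist_refl[OF group_axioms gen]
lemmas d_commute = word_dist_commute[OF group_axioms gen]
lemmas d_triangle = word_dist_triangle[OF group_axioms gen]
lemmas gens = gen_set[OF group_axioms gen]
lemmas mdist_vertices = mdist_Cay_vertices[OF group_axioms gen]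

lemma vertex_closed [simp]: "w \<in> lists A \<Longrightarrow> vertex w i \<in> carrier G"
  by (metis append_in_lists_conv append_take_drop_id elt_closed)

lemma take_in_lists [simp]: "w \<in> lists A \<Longrightarrow> take i w \<in> lists A"
  by (metis append_in_lists_conv append_take_drop_id)

lemma drop_in_lists [simp]: "w \<in> lists A \<Longrightarrow> drop i w \<in> lists A"
  by (metis append_in_lists_conv append_take_drop_id)

lemma d_left_mult:
  assumes "f \<in> carrier G" "g \<in> carrier G" "h \<in> carrier G"
  shows "d (f \<otimes> g) (f \<otimes> h) = d g h"
proof -
  have "inv (f \<otimes> g) \<otimes> (f \<otimes> h) = inv g \<otimes> (inv f \<otimes> (f \<otimes> h))"
    using assms by (simp add: inv_mult_group m_assoc)
  also have "inv f \<otimes> (f \<otimes> h) = h" using assms by (simp flip: m_assoc)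
  finally show ?thesis by (simp add: word_dist_def)
qed

lemma d_one: "g \<in> carrier G \<Longrightarrow> d \<one> g = real (word_length G A g)"
  by (simp add: word_dist_def)

lemma d_append:
  assumes "w \<in> lists A" "u \<in> lists A"
  shows "d (word_elt G w) (word_elt G (w @ u)) \<le> real (length u)"
proof -
  have "d (word_elt G w) (word_elt G (w @ u)) = d \<one> (word_elt G u)"
    using d_left_mult[of "word_elt G w" \<one> "word_elt G u"] assms by (simp add: elt_append)
  then show ?thesis
    using word_length_le[OF group_axioms gen assms(2)] assms by (simp add: d_one)
qed

lemma d_vertices_le:
  assumes "w \<in> lists A" "i \<le> j"
  shows "d (vertex w i) (vertex w j) \<le> real j - real i"
proof -
  have "take j w = take i w @ take (j - i) (drop i w)" using assms(2) by (metis le_add_diff_inverse take_add)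
  then have "d (vertex w i) (vertex w j) \<le> real (length (take (j - i) (drop i w)))"
    using d_append[of "take i w" "take (j - i) (drop i w)"] assms by simp
  also have "\<dots> \<le> real j - real i" using assms(2) by simp
  finally show ?thesis .
qed

lemma geodesic_rep:
  assumes "g \<in> carrier G"
  obtains w where "w \<in> lists A" "length w = word_length G A g" "word_elt G w = g"
  using word_length_word[OF group_axioms gen assms] by blast

definition ball :: "real \<Rightarrow> 'g set" where
  "ball r = {g \<in> carrier G. d \<one> g \<le> r}"

lemma finite_ball: "finite (ball r)"
proof (rule finite_subset)
  show "ball r \<subseteq> word_elt G ` {w. set w \<subseteq> A \<and> length w \<le> nat \<lfloor>r\<rfloor>}"
  proof
    fix g assume "g \<in> ball r"
    then have g: "g \<in> carrier G" "real (word_length G A g) \<le> r" by (auto simp: ball_def d_one)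
    obtain w where "w \<in> lists A" "length w = word_length G A g" "word_elt G w = g"
      using geodesic_rep[OF g(1)] .
    then show "g \<in> word_elt G ` {w. set w \<subseteq> A \<and> length w \<le> nat \<lfloor>r\<rfloor>}"
      using g(2) by (intro image_eqI[of _ _ w]) (auto simp: le_nat_floor)
  qed
  show "finite (word_elt G ` {w. set w \<subseteq> A \<and> length w \<le> nat \<lfloor>r\<rfloor>})"
    using gens(1) by (intro finite_imageI finite_lists_length_le)
qed

section \<open>Word paths and geodesic words\<close>

text \<open>
  At the right end \<open>t = length w\<close> both vertices of this triple are the endpoint of \<open>w\<close>, so one formula
  covers the whole path.
\<close>

definition path_triple :: "'g list \<Rightarrow> real \<Rightarrow> 'g \<times> 'g \<times> real" where
  "path_triple w t = (vertex w (nat \<lfloor>t\<rfloor>), vertex w (Suc (nat \<lfloor>t\<rfloor>)), t - real (nat \<lfloor>t\<rfloor>))"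

lemma word_path_triple:
  assumes "0 \<le> t" "t \<le> real (length w)"
  shows "word_path G A w t = cay_point G A (path_triple w t)"
proof (cases "nat \<lfloor>t\<rfloor> < length w")
  case True
  then show ?thesis by (simp add: word_path_def path_triple_def Let_def)
next
  case False
  then have "t = real (length w)" using assms by linarith
  then show ?thesis by (simp add: word_path_def path_triple_def cay_vertex_def)
qed

lemma path_triple_in:
  assumes "w \<in> lists A" "0 \<le> t" "t \<le> real (length w)"
  shows "path_triple w t \<in> cay_triples G A"
proof (cases "nat \<lfloor>t\<rfloor> < length w")
  case True
  let ?m = "nat \<lfloor>t\<rfloor>"
  have a: "w ! ?m \<in> A" using True assms(1) by (auto simp: in_lists_conv_set)
  have "vertex w (Suc ?m) = vertex w ?m \<otimes> w ! ?m"
    using True assms(1) a gens(2) by (auto simp: take_Suc_conv_app_nth elt_append)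
  then have "inv (vertex w ?m) \<otimes> vertex w (Suc ?m) = w ! ?m"
    using subsetD[OF gens(2) a] vertex_closed[OF assms(1), of ?m] by (simp flip: m_assoc)
  then show ?thesis using assms a
    by (auto simp: path_triple_def cay_triples_def) linarith+
next
  case False
  then have "t = real (length w)" using assms by linarith
  then show ?thesis using assms(1) by (simp add: path_triple_def cay_triples_def)
qed

lemma word_path_in:
  assumes "w \<in> lists A" "0 \<le> t" "t \<le> real (length w)"
  shows "word_path G A w t \<in> mspace (Cay G A)"
  using path_triple_in[OF assms] word_path_triple[OF assms(2,3)]
  by (simp add: mspace_Cay[OF group_axioms gen] cay_point_def quotientI)

lemma cay_vertex_in: "g \<in> carrier G \<Longrightarrow> cay_vertex G A g \<in> mspace (Cay G A)"
  by (simp add: mspace_Cay[OF group_axioms gen] cay_vertex_def cay_point_def quotientI cay_triples_def)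

lemma word_path_lipschitz:
  assumes "w \<in> lists A" "0 \<le> s" "s \<le> t" "t \<le> real (length w)"
  shows "mdist (Cay G A) (word_path G A w s) (word_path G A w t) \<le> t - s"
proof -
  let ?m = "nat \<lfloor>s\<rfloor>" and ?n = "nat \<lfloor>t\<rfloor>"
  have "triple_dist G A (path_triple w s) (path_triple w t) \<le> t - s"
  proof (cases "?m = ?n")
    case True
    have "\<bar>s - real ?m - (t - real ?n)\<bar> \<in> edge_lengths (path_triple w s) (path_triple w t)"
      using True by (simp add: path_triple_def)
    from triple_dist_le(1)[OF group_axioms gen this] show ?thesis using True assms by simp
  next
    case False
    then have mn: "Suc ?m \<le> ?n" using assms by linarith
    have "triple_dist G A (path_triple w s) (path_triple w t) \<le>
        (1 - (s - real ?m)) + d (vertex w (Suc ?m)) (vertex w ?n) + (t - real ?n)"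
      by (rule triple_dist_le(2)[OF group_axioms gen]) (simp_all add: path_triple_def)
    then show ?thesis using d_vertices_le[OF assms(1) mn] by simp
  qed
  then show ?thesis
    using assms path_triple_in[OF assms(1)]
    by (simp add: word_path_triple mdist_Cay[OF group_axioms gen])
qed

lemma word_path_near_vertex:
  assumes "w \<in> lists A" "0 \<le> t" "t \<le> real (length w)"
  shows "mdist (Cay G A) (word_path G A w t) (cay_vertex G A (vertex w (nat \<lfloor>t\<rfloor>)))
    \<le> t - real (nat \<lfloor>t\<rfloor>)"
proof -
  let ?g = "vertex w (nat \<lfloor>t\<rfloor>)"
  have "triple_dist G A (path_triple w t) (?g, ?g, 0) \<le> (t - real (nat \<lfloor>t\<rfloor>)) + d ?g ?g + 0"
    by (rule triple_dist_le(2)[OF group_axioms gen]) (simp_all add: path_triple_def)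
  moreover have "(?g, ?g, 0) \<in> cay_triples G A" using assms by (simp add: cay_triples_def)
  ultimately show ?thesis
    using assms path_triple_in[OF assms]
    by (simp add: word_path_triple cay_vertex_def mdist_Cay[OF group_axioms gen])
qed

lemma word_path_nat:
  assumes "w \<in> lists A" "i \<le> length w"
  shows "word_path G A w (real i) = cay_vertex G A (vertex w i)"
proof -
  have "mdist (Cay G A) (word_path G A w (real i)) (cay_vertex G A (vertex w i)) \<le> 0"
    using word_path_near_vertex[of w "real i"] assms by simp
  then show ?thesis
    using word_path_in[of w "real i"] cay_vertex_in[of "vertex w i"] assms
    by (metis mdist_nonneg mdist_zero nle_le of_nat_0_le_iff of_nat_le_iff vertex_closed)
qed

text \<open>
  Word paths are 1-Lipschitz, so a word path of length \<open>n\<close> whose ends are at distance \<open>n\<close> cannot lose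
  any distance on the way.
\<close>

lemma geodesic_word_iff:
  "geodesic_word G A w \<longleftrightarrow> w \<in> lists A \<and> word_length G A (word_elt G w) = length w"
proof (intro iffI conjI)
  assume w: "geodesic_word G A w"
  then show wA: "w \<in> lists A" by (simp add: geodesic_word_def)
  have "\<bar>0 - real (length w)\<bar> \<le> mdist (Cay G A) (word_path G A w 0) (word_path G A w (real (length w)))"
    using quasi_geodesicD(2)[of "Cay G A" 1 0 "{0..real (length w)}" "word_path G A w" 0 "real (length w)"] w
    by (simp add: geodesic_word_def geodesic_def)
  also have "\<dots> = d \<one> (word_elt G w)"
    using word_path_nat[OF wA, of 0] word_path_nat[OF wA, of "length w"] wA by (simp add: mdist_vertices)
  finally show "word_length G A (word_elt G w) = length w"
    using word_length_le[OF group_axioms gen wA] wA by (simp add: d_one)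
next
  assume *: "w \<in> lists A \<and> word_length G A (word_elt G w) = length w"
  then have wA: "w \<in> lists A" by simp
  let ?p = "word_path G A w" and ?D = "mdist (Cay G A)" and ?n = "real (length w)"
  have n: "?D (?p 0) (?p ?n) = ?n"
    using word_path_nat[OF wA, of 0] word_path_nat[OF wA, of "length w"] *
    by (simp add: mdist_vertices d_one)
  have eq: "?D (?p s) (?p t) = t - s" if "0 \<le> s" "s \<le> t" "t \<le> ?n" for s t
  proof -
    have mem: "?p 0 \<in> mspace (Cay G A)" "?p s \<in> mspace (Cay G A)" "?p t \<in> mspace (Cay G A)"
        "?p ?n \<in> mspace (Cay G A)"
      using that wA by (simp_all add: word_path_in)
    have "?D (?p 0) (?p ?n) \<le> ?D (?p 0) (?p s) + ?D (?p s) (?p t) + ?D (?p t) (?p ?n)"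
      using mdist_triangle[OF mem(1,2,4)] mdist_triangle[OF mem(2,3,4)] by linarith
    then show ?thesis
      using n that word_path_lipschitz[OF wA, of 0 s] word_path_lipschitz[OF wA, of s t]
        word_path_lipschitz[OF wA, of t ?n] by linarith
  qed
  have "?D (?p s) (?p t) = \<bar>s - t\<bar>" if "s \<in> {0..?n}" "t \<in> {0..?n}" for s t
    using eq[of s t] eq[of t s] that mdist_commute[of "Cay G A" "?p s" "?p t"] by (cases "s \<le> t") auto
  then show "geodesic_word G A w"
    using wA word_path_in[OF wA]
    by (auto simp: geodesic_word_def geodesic_def quasi_geodesic_def closed_interval_def is_interval_cc)
qed

lemma geodesic_word_lists: "geodesic_word G A w \<Longrightarrow> w \<in> lists A"
  by (simp add: geodesic_word_def)

lemma geodesic_word_d: "geodesic_word G A w \<Longrightarrow> d \<one> (word_elt G w) = real (length w)"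
  by (simp add: geodesic_word_iff d_one)

lemma geodesic_word_exists:
  assumes "g \<in> carrier G"
  obtains w where "geodesic_word G A w" "word_elt G w = g"
  using geodesic_rep[OF assms] geodesic_word_iff by metis

lemma geodesic_word_take:
  assumes "geodesic_word G A w"
  shows "geodesic_word G A (take i w)"
proof (cases "i \<le> length w")
  case True
  have wA: "w \<in> lists A" using assms by (rule geodesic_word_lists)
  have "d \<one> (word_elt G w) \<le> d \<one> (vertex w i) + d (vertex w i) (vertex w (length w))"
    using wA by (simp add: d_triangle)
  then have "real i \<le> d \<one> (vertex w i)"
    using d_vertices_le[OF wA True] geodesic_word_d[OF assms] by linarith
  then show ?thesis
    using True wA word_length_le[OF group_axioms gen, of "take i w"]
    by (simp add: geodesic_word_iff d_one)
qed (use assms in simp)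

lemma geodesic_vertices:
  assumes "geodesic_word G A w" "i \<le> length w" "j \<le> length w"
  shows "d (vertex w i) (vertex w j) = \<bar>real i - real j\<bar>"
proof -
  have wA: "w \<in> lists A" using assms(1) by (rule geodesic_word_lists)
  have *: "d (vertex w i) (vertex w j) = real j - real i" if "i \<le> j" "j \<le> length w" for i j
  proof -
    have "d \<one> (vertex w j) \<le> d \<one> (vertex w i) + d (vertex w i) (vertex w j)"
      using wA by (simp add: d_triangle)
    then show ?thesis
      using geodesic_word_d[OF geodesic_word_take[OF assms(1)], of i] that
        geodesic_word_d[OF geodesic_word_take[OF assms(1)], of j] d_vertices_le[OF wA that(1)] by simp
  qed
  show ?thesis
    using *[of i j] *[of j i] assms d_commute[of "vertex w i" "vertex w j"] wA by (cases "i \<le> j") auto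
qed

section \<open>Quasi-geodesics near a Morse word\<close>

text \<open>
  Quasi-geodesics need not be continuous, so it suffices to consider those that visit only vertices;
  they can be described by the word metric alone.
\<close>

definition vertex_quasi_geodesic :: "real \<Rightarrow> real \<Rightarrow> real \<Rightarrow> real \<Rightarrow> (real \<Rightarrow> 'g) \<Rightarrow> bool" where
  "vertex_quasi_geodesic k c a b p \<longleftrightarrow> p \<in> {a..b} \<rightarrow> carrier G \<and>
     (\<forall>s\<in>{a..b}. \<forall>t\<in>{a..b}. 1 / k * \<bar>s - t\<bar> - c \<le> d (p s) (p t) \<and>
                               d (p s) (p t) \<le> k * \<bar>s - t\<bar> + c)"

lemma vertex_quasi_geodesicD:
  assumes "vertex_quasi_geodesic k c a b p" "s \<in> {a..b}" "t \<in> {a..b}"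
  shows "p s \<in> carrier G" "1 / k * \<bar>s - t\<bar> - c \<le> d (p s) (p t)"
    "d (p s) (p t) \<le> k * \<bar>s - t\<bar> + c"
  using assms unfolding vertex_quasi_geodesic_def by blast+

lemma d_perturb:
  assumes "f \<in> carrier G" "g \<in> carrier G" "f' \<in> carrier G" "g' \<in> carrier G"
    "d f f' \<le> D" "d g g' \<le> D"
  shows "\<bar>d f g - d f' g'\<bar> \<le> 2 * D"
  using d_triangle[of f f' g] d_triangle[of f' g' g] d_triangle[of f' f g'] d_triangle[of f g g']
    d_commute[of f f'] d_commute[of g g'] assms by linarith

text \<open>
  The Morse property of words in terms of vertices, for quasi-geodesics that only start and end
  near the word.
\<close>

lemma Morse_word_vertices:
  assumes w: "w \<in> lists A" and Morse: "is_Morse (Cay G A) M {0..real (length w)} (word_path G A w)"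
    and M: "morse_gauge M" and ij: "i \<le> j" "j \<le> length w"
    and par: "k \<ge> 1" "c \<ge> 0" "D \<ge> 0"
    and p: "vertex_quasi_geodesic k c a b p"
    and ends: "d (p a) (vertex w i) \<le> D" "d (p b) (vertex w j) \<le> D"
    and r: "r \<in> {a..b}"
  obtains l where "i \<le> l" "l \<le> j" "d (p r) (vertex w l) \<le> M k (c + 2 * D) + 1 + D"
proof -
  have M0: "0 \<le> M k (c + 2 * D)" using M par by (simp add: morse_gauge_def)
  consider "r = a" | "r = b" | "a < r" "r < b" using r by force
  then show ?thesis
  proof cases
    case 1
    then show ?thesis using that[of i] ij ends M0 by simp
  next
    case 2
    then show ?thesis using that[of j] ij ends M0 by simp
  next
    case 3
    \<comment> \<open>Moving the two ends onto the word costs \<open>2 * D\<close> in the additive constant, and the values inside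
      the interval remain the same.\<close>
    define q where "q = p(a := vertex w i, b := vertex w j)"
    have near: "d (q s) (p s) \<le> D" "q s \<in> carrier G" "p s \<in> carrier G" if "s \<in> {a..b}" for s
    proof -
      show ps: "p s \<in> carrier G" using p that unfolding vertex_quasi_geodesic_def by blast
      then show "q s \<in> carrier G" by (simp add: q_def w)
      show "d (q s) (p s) \<le> D"
        using ends ps par vertex_closed[OF w, of i] vertex_closed[OF w, of j]
        by (auto simp: q_def d_commute[of _ "p a"] d_commute[of _ "p b"])
    qed
    have "quasi_geodesic (Cay G A) k (c + 2 * D) {a..b} (\<lambda>s. cay_vertex G A (q s))"
      unfolding quasi_geodesic_def
    proof (intro conjI ballI)
      show "closed_interval {a..b}" using r by (auto simp: closed_interval_def is_interval_cc)
      show "(\<lambda>s. cay_vertex G A (q s)) \<in> {a..b} \<rightarrow> mspace (Cay G A)"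
        using near by (auto intro: cay_vertex_in)
      fix s t assume st: "s \<in> {a..b}" "t \<in> {a..b}"
      have "\<bar>d (q s) (q t) - d (p s) (p t)\<bar> \<le> 2 * D"
        using near st by (intro d_perturb) auto
      then show "1 / k * \<bar>s - t\<bar> - (c + 2 * D) \<le> mdist (Cay G A) (cay_vertex G A (q s)) (cay_vertex G A (q t))"
        "mdist (Cay G A) (cay_vertex G A (q s)) (cay_vertex G A (q t)) \<le> k * \<bar>s - t\<bar> + (c + 2 * D)"
        using vertex_quasi_geodesicD(2,3)[OF p st] near st by (simp_all add: mdist_vertices)
    qed (use par in auto)
    moreover have "cay_vertex G A (q a) = word_path G A w (real i)"
      "cay_vertex G A (q b) = word_path G A w (real j)"
      using 3 w ij by (simp_all add: q_def word_path_nat)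
    moreover have "real i \<le> real j" "{real i..real j} \<subseteq> {0..real (length w)}" "a \<le> b"
      using ij r by auto
    ultimately have "(\<lambda>s. cay_vertex G A (q s)) ` {a..b} \<subseteq>
        nbhd (Cay G A) (M k (c + 2 * D)) (word_path G A w ` {real i..real j})"
      using Morse unfolding is_Morse_def by meson
    then have "cay_vertex G A (q r) \<in> nbhd (Cay G A) (M k (c + 2 * D)) (word_path G A w ` {real i..real j})"
      using r by blast
    then obtain u where u: "u \<in> {real i..real j}"
      "mdist (Cay G A) (cay_vertex G A (q r)) (word_path G A w u) \<le> M k (c + 2 * D)"
      unfolding nbhd_def by auto
    let ?l = "nat \<lfloor>u\<rfloor>"
    have l: "i \<le> ?l" "?l \<le> j" using u(1) by (auto simp: le_nat_floor le_floor_iff) linarith+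
    have u': "0 \<le> u" "u \<le> real (length w)" using u(1) ij by auto
    have pr: "p r \<in> carrier G" "q r = p r" using near(3)[OF r] 3 by (simp_all add: q_def)
    have "mdist (Cay G A) (cay_vertex G A (p r)) (cay_vertex G A (vertex w ?l)) \<le>
       mdist (Cay G A) (cay_vertex G A (p r)) (word_path G A w u) +
       mdist (Cay G A) (word_path G A w u) (cay_vertex G A (vertex w ?l))"
      using pr w u' by (intro mdist_triangle cay_vertex_in word_path_in) auto
    also have "\<dots> \<le> M k (c + 2 * D) + 1"
      using u(2) word_path_near_vertex[OF w u'] pr(2) u' by simp linarith
    finally have "d (p r) (vertex w ?l) \<le> M k (c + 2 * D) + 1 + D"
      using pr w par by (simp add: mdist_vertices)
    then show ?thesis using that l by blast
  qed
qed

lemma vertex_quasi_geodesic_reverse: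
  "vertex_quasi_geodesic k c a b p \<Longrightarrow> vertex_quasi_geodesic k c (- b) (- a) (\<lambda>t. p (- t))"
  unfolding vertex_quasi_geodesic_def
proof (intro conjI ballI; elim conjE)
  fix s t :: real
  assume st: "s \<in> {- b..- a}" "t \<in> {- b..- a}"
    and p: "\<forall>s\<in>{a..b}. \<forall>t\<in>{a..b}. 1 / k * \<bar>s - t\<bar> - c \<le> d (p s) (p t) \<and>
                               d (p s) (p t) \<le> k * \<bar>s - t\<bar> + c"
  have eq: "\<bar>- s - - t\<bar> = \<bar>s - t\<bar>" by simp
  have "- s \<in> {a..b}" "- t \<in> {a..b}" using st by auto
  from p[rule_format, OF this]
  show "1 / k * \<bar>s - t\<bar> - c \<le> d (p (- s)) (p (- t))" "d (p (- s)) (p (- t)) \<le> k * \<bar>s - t\<bar> + c"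
    unfolding eq by auto
qed auto

text \<open>
  A quasi-geodesic that follows a word from the identity to the other end may turn back for a bounded
  time, so both orders of \<open>i\<close> and \<open>j\<close> occur. Reversing \<open>p\<close> exchanges them.
\<close>

lemma Morse_word_vertices_symmetric:
  assumes w: "w \<in> lists A" and Morse: "is_Morse (Cay G A) M {0..real (length w)} (word_path G A w)"
    and M: "morse_gauge M" and ij: "i \<le> length w" "j \<le> length w"
    and par: "k \<ge> 1" "c \<ge> 0" "D \<ge> 0"
    and p: "vertex_quasi_geodesic k c a b p"
    and ends: "d (p a) (vertex w i) \<le> D" "d (p b) (vertex w j) \<le> D"
    and r: "r \<in> {a..b}"
  obtains l where "min i j \<le> l" "l \<le> max i j" "d (p r) (vertex w l) \<le> M k (c + 2 * D) + 1 + D"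
proof (cases "i \<le> j")
  case True
  then show ?thesis
    using Morse_word_vertices[OF w Morse M True ij(2) par p ends r] that
    by (metis min.absorb1 max.absorb2)
next
  case False
  then have ji: "j \<le> i" by simp
  have e: "d (p (- (- b))) (vertex w j) \<le> D" "d (p (- (- a))) (vertex w i) \<le> D" "- r \<in> {- b..- a}"
    using ends r by auto
  show ?thesis
    using Morse_word_vertices[OF w Morse M ji ij(1) par vertex_quasi_geodesic_reverse[OF p] e] that ji
    by (metis min.absorb2 max.absorb1 minus_minus)
qed

text \<open>
  The additive constant grows by 1 because rounding \<open>s\<close> and \<open>t\<close> down may change \<open>\<bar>s - t\<bar>\<close> by up to 1.
\<close>

lemma word_vertex_quasi_geodesic:
  assumes w: "w \<in> lists A" and c: "c \<ge> 0"
    and lower: "\<And>i j. i \<le> j \<Longrightarrow> j \<le> length w \<Longrightarrow> real j - real i - c \<le> d (vertex w i) (vertex w j)"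
  shows "vertex_quasi_geodesic 1 (c + 1) 0 (real (length w)) (\<lambda>t. vertex w (nat \<lfloor>t\<rfloor>))"
  unfolding vertex_quasi_geodesic_def
proof (intro conjI ballI)
  have le: "\<bar>s - t\<bar> - (c + 1) \<le> d (vertex w (nat \<lfloor>s\<rfloor>)) (vertex w (nat \<lfloor>t\<rfloor>)) \<and>
     d (vertex w (nat \<lfloor>s\<rfloor>)) (vertex w (nat \<lfloor>t\<rfloor>)) \<le> \<bar>s - t\<bar> + (c + 1)"
    if st: "0 \<le> s" "s \<le> t" "t \<le> real (length w)" for s t
  proof -
    have ij: "nat \<lfloor>s\<rfloor> \<le> nat \<lfloor>t\<rfloor>" "nat \<lfloor>t\<rfloor> \<le> length w" using st by linarith+
    show ?thesis
      using lower[OF ij] d_vertices_le[OF w ij(1)] st c by linarith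
  qed
  fix s t :: real
  assume "s \<in> {0..real (length w)}" "t \<in> {0..real (length w)}"
  then show "1 / 1 * \<bar>s - t\<bar> - (c + 1) \<le> d (vertex w (nat \<lfloor>s\<rfloor>)) (vertex w (nat \<lfloor>t\<rfloor>))"
    "d (vertex w (nat \<lfloor>s\<rfloor>)) (vertex w (nat \<lfloor>t\<rfloor>)) \<le> 1 * \<bar>s - t\<bar> + (c + 1)"
    using le[of s t] le[of t s] w
      d_commute[of "vertex w (nat \<lfloor>s\<rfloor>)" "vertex w (nat \<lfloor>t\<rfloor>)"] by (cases "s \<le> t"; simp add: abs_minus_commute)+
qed (use w in auto)

text \<open>
  When a word is extended letter by letter as long as it is geodesic, the first word that fails is
  of this kind. It is still a quasi-geodesic with fixed constants.
\<close>

definition almost_geodesic :: "'g list \<Rightarrow> bool" where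
  "almost_geodesic w \<longleftrightarrow> w \<in> lists A \<and> geodesic_word G A (butlast w)"

lemma geodesic_imp_almost: "geodesic_word G A w \<Longrightarrow> almost_geodesic w"
  unfolding almost_geodesic_def
  by (metis butlast_conv_take geodesic_word_lists geodesic_word_take)

lemma almost_geodesic_lower:
  assumes w: "almost_geodesic w" and ij: "i \<le> j" "j \<le> length w"
  shows "real j - real i - 2 \<le> d (vertex w i) (vertex w j)"
proof -
  have wA: "w \<in> lists A" and g: "geodesic_word G A (butlast w)"
    using w by (simp_all add: almost_geodesic_def)
  define n where "n = length w - 1"
  have v: "vertex (butlast w) l = vertex w l" if "l \<le> n" for l
    using that by (simp add: butlast_conv_take n_def)
  have near: "d (vertex w (min l n)) (vertex w l) \<le> 1" if "l \<le> length w" for l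
    using d_vertices_le[OF wA, of "min l n" l] that unfolding n_def by linarith
  have "d (vertex w (min i n)) (vertex w (min j n)) = \<bar>real (min i n) - real (min j n)\<bar>"
    using geodesic_vertices[OF g, of "min i n" "min j n"] v by (simp add: n_def)
  moreover have "\<bar>d (vertex w (min i n)) (vertex w (min j n)) - d (vertex w i) (vertex w j)\<bar> \<le> 1"
    if "i \<noteq> j"
  proof -
    have "i \<le> n" using that ij unfolding n_def by simp
    then show ?thesis
      using d_triangle[of "vertex w i" "vertex w (min j n)" "vertex w j"]
        d_triangle[of "vertex w i" "vertex w j" "vertex w (min j n)"]
        near[OF ij(2)] d_commute[of "vertex w (min j n)" "vertex w j"] wA by simp
  qed
  moreover have "real j - real i \<le> real (min j n) - real (min i n) + 1" if "i \<noteq> j"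
    using ij that unfolding n_def by linarith
  moreover have "0 \<le> d (vertex w i) (vertex w j)" by simp
  ultimately show ?thesis by (cases "i = j") linarith+
qed

text \<open>
  Being near some vertex of \<open>z\<close> improves to being near the vertex of \<open>z\<close> with the same index, because
  the index of a vertex agrees with its distance from the identity, up to 2 in the case of \<open>w\<close>.
\<close>

lemma almost_geodesic_near_Morse_word:
  assumes w: "almost_geodesic w" and z: "geodesic_word G A z"
    and Morse: "is_Morse (Cay G A) M {0..real (length z)} (word_path G A z)" and M: "morse_gauge M"
    and D: "d (word_elt G w) (word_elt G z) \<le> D" and i: "i \<le> length w"
  shows "d (vertex w i) (vertex z i) \<le> 2 * (M 1 (3 + 2 * D) + 1 + D) + 2"
proof -
  have wA: "w \<in> lists A" and zA: "z \<in> lists A"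
    using w z by (simp_all add: almost_geodesic_def geodesic_word_lists)
  let ?R = "M 1 (3 + 2 * D) + 1 + D"
  have D0: "0 \<le> D" using D word_dist_nonneg by (rule order_trans[rotated])
  have "vertex_quasi_geodesic 1 3 0 (real (length w)) (\<lambda>t. vertex w (nat \<lfloor>t\<rfloor>))"
    using word_vertex_quasi_geodesic[OF wA, of 2] almost_geodesic_lower[OF w] by simp
  then obtain l where l: "l \<le> length z" "d (vertex w i) (vertex z l) \<le> ?R"
    using Morse_word_vertices[OF zA Morse M, of 0 "length z" 1 3 D 0 "real (length w)"
        "\<lambda>t. vertex w (nat \<lfloor>t\<rfloor>)" "real i"] D D0 i by auto
  have "d \<one> (vertex w i) \<le> real i" "real i - 2 \<le> d \<one> (vertex w i)"
    using d_vertices_le[OF wA, of 0 i] almost_geodesic_lower[OF w, of 0 i] i by simp_all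
  moreover have "d \<one> (vertex z l) = real l"
    using geodesic_word_d[OF geodesic_word_take[OF z, of l]] l by simp
  moreover have "d \<one> (vertex z l) \<le> d \<one> (vertex w i) + d (vertex w i) (vertex z l)"
    "d \<one> (vertex w i) \<le> d \<one> (vertex z l) + d (vertex z l) (vertex w i)"
    using wA zA by (simp_all add: d_triangle)
  ultimately have il: "\<bar>real i - real l\<bar> \<le> ?R + 2"
    using l(2) d_commute[of "vertex w i" "vertex z l"] wA zA by simp
  have "vertex z (min i (length z)) = vertex z i" by (simp add: min_def)
  moreover have "d (vertex z l) (vertex z (min i (length z))) = \<bar>real l - real (min i (length z))\<bar>"
    using l by (intro geodesic_vertices[OF z]) auto
  moreover have "\<bar>real l - real (min i (length z))\<bar> \<le> \<bar>real i - real l\<bar>" using l(1) by linarith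
  moreover have "d (vertex w i) (vertex z i) \<le> d (vertex w i) (vertex z l) + d (vertex z l) (vertex z i)"
    using wA zA by (simp add: d_triangle)
  ultimately show ?thesis using il l(2) by simp
qed

end

section \<open>Change of generating set\<close>

text \<open>
  An intermediate value theorem for functions with jumps. It serves to show that a quasi-geodesic
  which follows a segment of a word from one end to the other misses no part of it.
\<close>

lemma coarse_intermediate_value:
  fixes f :: "real \<Rightarrow> real"
  assumes "s \<le> t"
    and jump: "\<And>x y. x \<in> {s..t} \<Longrightarrow> y \<in> {s..t} \<Longrightarrow> \<bar>x - y\<bar> \<le> 1 \<Longrightarrow> \<bar>f x - f y\<bar> \<le> L"
    and l: "min (f s) (f t) \<le> l" "l \<le> max (f s) (f t)"
  obtains x where "x \<in> {s..t}" "\<bar>f x - l\<bar> \<le> L"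
proof -
  have *: "\<exists>x\<in>{s..t}. \<bar>g x - m\<bar> \<le> L"
    if g: "\<And>x y. x \<in> {s..t} \<Longrightarrow> y \<in> {s..t} \<Longrightarrow> \<bar>x - y\<bar> \<le> 1 \<Longrightarrow> \<bar>g x - g y\<bar> \<le> L"
      and m: "g s \<le> m" "m \<le> g t" for g :: "real \<Rightarrow> real" and m
  proof -
    \<comment> \<open>The value \<open>m\<close> is passed at the supremum of \<open>S\<close>; \<open>x\<close> and \<open>y\<close> below are taken on the two sides of
      it, so that their distance is at most 1.\<close>
    define S where "S = {x \<in> {s..t}. g x \<le> m}"
    have S: "S \<noteq> {}" "bdd_above S" using m(1) \<open>s \<le> t\<close> by (auto simp: S_def)
    have "Sup S - 1 / 2 < Sup S" by simp
    then obtain x where x: "x \<in> S" "Sup S - 1 / 2 < x"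
      using less_cSup_iff[OF S] by blast
    have "x \<le> Sup S" using x(1) S(2) by (rule cSup_upper)
    define y where "y = min t (Sup S + 1 / 2)"
    have y: "y \<in> {s..t}" "\<bar>x - y\<bar> \<le> 1"
      using x \<open>x \<le> Sup S\<close> \<open>s \<le> t\<close> by (auto simp: y_def S_def min_def)
    have "m \<le> g y"
    proof (cases "y = t")
      case False
      then have "Sup S < y" by (auto simp: y_def min_def split: if_splits)
      then have "y \<notin> S" using cSup_upper[OF _ S(2)] by force
      then show ?thesis using y by (auto simp: S_def)
    qed (use m in simp)
    moreover have "g x \<le> m" "x \<in> {s..t}" using x by (auto simp: S_def)
    ultimately show ?thesis using g[OF _ y(1), of x] y(2) by (intro bexI[of _ x]) auto
  qed
  show ?thesis
  proof (cases "f s \<le> f t")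
    case True
    then show ?thesis using *[of f l] jump l that by auto
  next
    case False
    have "\<bar>- f x - - f y\<bar> \<le> L" if "x \<in> {s..t}" "y \<in> {s..t}" "\<bar>x - y\<bar> \<le> 1" for x y
      using jump[OF that] by linarith
    then obtain x where "x \<in> {s..t}" "\<bar>- f x - - l\<bar> \<le> L"
      using *[of "\<lambda>x. - f x" "- l"] False l by auto
    then show ?thesis using that[of x] by linarith
  qed
qed

context cayley
begin

definition near_vertex :: "'g cay_point \<Rightarrow> 'g" where
  "near_vertex P = (SOME g. g \<in> carrier G \<and> mdist (Cay G A) P (cay_vertex G A g) \<le> 1)"

lemma near_vertex:
  assumes "P \<in> mspace (Cay G A)"
  shows "near_vertex P \<in> carrier G" "mdist (Cay G A) P (cay_vertex G A (near_vertex P)) \<le> 1"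
proof -
  have "P \<in> cay_triples G A // cay_rel G A"
    using assms by (simp add: mspace_Cay[OF group_axioms gen])
  then obtain x where x: "x \<in> cay_triples G A" "P = cay_point G A x"
    unfolding quotient_def cay_point_def by blast
  obtain u v t where uvt: "x = (u, v, t)" by (cases x)
  have u: "u \<in> carrier G" "t \<le> 1" using x(1) by (auto simp: uvt cay_triples_def)
  then have "(u, u, 0) \<in> cay_triples G A" by (simp add: cay_triples_def)
  moreover have "triple_dist G A x (u, u, 0) \<le> t + d u u + 0"
    by (rule triple_dist_le(2)[OF group_axioms gen]) (simp_all add: uvt)
  ultimately have "mdist (Cay G A) P (cay_vertex G A u) \<le> 1"
    using x u by (simp add: cay_vertex_def mdist_Cay[OF group_axioms gen])
  then have "near_vertex P \<in> carrier G \<and> mdist (Cay G A) P (cay_vertex G A (near_vertex P)) \<le> 1"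
    using someI[of "\<lambda>g. g \<in> carrier G \<and> mdist (Cay G A) P (cay_vertex G A g) \<le> 1" u] u(1)
    unfolding near_vertex_def by blast
  then show "near_vertex P \<in> carrier G" "mdist (Cay G A) P (cay_vertex G A (near_vertex P)) \<le> 1"
    by simp_all
qed

lemma near_vertex_dist:
  assumes "P \<in> mspace (Cay G A)" "Q \<in> mspace (Cay G A)"
  shows "\<bar>d (near_vertex P) (near_vertex Q) - mdist (Cay G A) P Q\<bar> \<le> 2"
proof -
  let ?D = "mdist (Cay G A)" and ?p = "cay_vertex G A (near_vertex P)" and ?q = "cay_vertex G A (near_vertex Q)"
  have v: "?p \<in> mspace (Cay G A)" "?q \<in> mspace (Cay G A)"
    using assms by (simp_all add: cay_vertex_in near_vertex)
  have "?D ?p ?q = d (near_vertex P) (near_vertex Q)" using assms by (simp add: mdist_vertices near_vertex)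
  then show ?thesis
    using mdist_triangle[OF assms(1) v(1) assms(2)] mdist_triangle[OF v assms(2)]
      mdist_triangle[OF v(1) assms(1) v(2)] mdist_triangle[OF assms v(2)]
      near_vertex(2)[OF assms(1)] near_vertex(2)[OF assms(2)]
      mdist_commute[of "Cay G A" ?p P] mdist_commute[of "Cay G A" ?q Q] by linarith
qed

lemma near_vertex_dist_vertex:
  assumes "P \<in> mspace (Cay G A)" "g \<in> carrier G"
  shows "\<bar>d (near_vertex P) g - mdist (Cay G A) P (cay_vertex G A g)\<bar> \<le> 1"
proof -
  let ?D = "mdist (Cay G A)" and ?p = "cay_vertex G A (near_vertex P)" and ?q = "cay_vertex G A g"
  have v: "?p \<in> mspace (Cay G A)" "?q \<in> mspace (Cay G A)"
    using assms by (simp_all add: cay_vertex_in near_vertex)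
  have "?D ?p ?q = d (near_vertex P) g" using assms by (simp add: mdist_vertices near_vertex)
  then show ?thesis
    using mdist_triangle[OF assms(1) v] mdist_triangle[OF v(1) assms(1) v(2)]
      near_vertex(2)[OF assms(1)] mdist_commute[of "Cay G A" ?p P] by linarith
qed

lemma word_dist_lipschitz:
  assumes "finite_gen_set G B"
  obtains K where "K \<ge> 1" "\<And>g h. g \<in> carrier G \<Longrightarrow> h \<in> carrier G \<Longrightarrow> word_dist G B g h \<le> K * d g h"
proof -
  interpret B: cayley G B by unfold_locales (rule assms)
  define K where "K = Max (insert 1 (B.d \<one> ` A))"
  have K: "1 \<le> K" "\<And>a. a \<in> A \<Longrightarrow> B.d \<one> a \<le> K" using gens(1) by (simp_all add: K_def)
  have word: "B.d \<one> (word_elt G w) \<le> K * real (length w)" if "w \<in> lists A" for w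
    using that
  proof (induction w)
    case (Cons a w)
    then have a: "a \<in> carrier G" "a \<in> A" "word_elt G w \<in> carrier G" using gens(2) by auto
    then have "B.d \<one> (a \<otimes> word_elt G w) \<le> B.d \<one> a + B.d \<one> (word_elt G w)"
      using B.d_triangle[of \<one> a "a \<otimes> word_elt G w"] B.d_left_mult[of a \<one> "word_elt G w"] by simp
    then show ?case using Cons K(2)[OF a(2)] by (simp add: algebra_simps)
  qed simp
  have "B.d g h \<le> K * d g h" if gh: "g \<in> carrier G" "h \<in> carrier G" for g h
  proof -
    have "inv g \<otimes> h \<in> carrier G" using gh by simp
    then obtain w where "w \<in> lists A" "length w = word_length G A (inv g \<otimes> h)"
      "word_elt G w = inv g \<otimes> h" by (rule geodesic_rep)
    then have "B.d \<one> (inv g \<otimes> h) \<le> K * d g h" using word[of w] by (simp add: word_dist_def)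
    then show ?thesis using gh by (simp add: word_dist_def)
  qed
  with K(1) show ?thesis by (rule that)
qed

text \<open>
  The word metrics of two finite generating sets are bilipschitz equivalent, so quasi-geodesics of
  one Cayley graph turn into quasi-geodesics of the other one.
\<close>

lemma quasi_geodesic_near_vertices:
  assumes B: "cayley G B"
    and K: "K \<ge> 1" "\<And>g h. g \<in> carrier G \<Longrightarrow> h \<in> carrier G \<Longrightarrow> word_dist G B g h \<le> K * d g h"
      "\<And>g h. g \<in> carrier G \<Longrightarrow> h \<in> carrier G \<Longrightarrow> d g h \<le> K * word_dist G B g h"
    and \<eta>: "quasi_geodesic (Cay G B) k c {a..b} \<eta>"
  shows "vertex_quasi_geodesic (k * K) (K * (c + 2)) a b (\<lambda>t. cayley.near_vertex G B (\<eta> t))"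
  unfolding vertex_quasi_geodesic_def
proof (intro conjI ballI)
  interpret B: cayley G B by (rule B)
  have k: "k \<ge> 1" "c \<ge> 0" using \<eta> by (simp_all add: quasi_geodesic_def)
  show "(\<lambda>t. B.near_vertex (\<eta> t)) \<in> {a..b} \<rightarrow> carrier G"
    using B.near_vertex(1) quasi_geodesicD(1)[OF \<eta>] by blast
  fix s t assume st: "s \<in> {a..b}" "t \<in> {a..b}"
  let ?p = "B.near_vertex (\<eta> s)" and ?q = "B.near_vertex (\<eta> t)"
  have in_B: "\<eta> s \<in> mspace (Cay G B)" "\<eta> t \<in> mspace (Cay G B)"
    using quasi_geodesicD(1)[OF \<eta>] st by blast+
  then have pq: "?p \<in> carrier G" "?q \<in> carrier G" by (simp_all add: B.near_vertex)
  have B_dist: "1 / k * \<bar>s - t\<bar> - (c + 2) \<le> B.d ?p ?q" "B.d ?p ?q \<le> k * \<bar>s - t\<bar> + (c + 2)"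
    using B.near_vertex_dist[OF in_B] quasi_geodesicD(2,3)[OF \<eta> st] by linarith+
  have "d ?p ?q \<le> K * B.d ?p ?q" by (rule K(3)[OF pq])
  also have "\<dots> \<le> K * (k * \<bar>s - t\<bar> + (c + 2))" using B_dist(2) K(1) by (intro mult_left_mono) auto
  finally show "d ?p ?q \<le> k * K * \<bar>s - t\<bar> + K * (c + 2)" by (simp add: algebra_simps)
  have "(1 / k * \<bar>s - t\<bar> - (c + 2)) / K \<le> d ?p ?q"
    using B_dist(1) K(2)[OF pq] K(1) by (simp add: divide_le_eq mult.commute)
  moreover have "(c + 2) / K \<le> K * (c + 2)"
  proof -
    have "(c + 2) / K \<le> (c + 2) * 1" using K(1) k by (simp add: divide_le_eq mult_left_mono)
    also have "\<dots> \<le> (c + 2) * K" using K(1) k by (intro mult_left_mono) auto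
    finally show ?thesis by (simp add: mult.commute)
  qed
  ultimately show "1 / (k * K) * \<bar>s - t\<bar> - K * (c + 2) \<le> d ?p ?q"
    by (simp add: diff_divide_distrib)
qed

text \<open>
  Let \<open>\<gamma>\<close> be a geodesic of the Cayley graph of \<open>B\<close> from the identity to \<open>h\<close>, and \<open>w\<close> a geodesic word over
  \<open>A\<close> for \<open>h\<close>. Seen in the Cayley graph of \<open>A\<close>, \<open>\<gamma>\<close> is a quasi-geodesic, so it stays within \<open>R\<close> of \<open>w\<close>;
  as \<open>w\<close> stays near \<open>H\<close>, so does \<open>\<gamma>\<close>. A quasi-geodesic \<open>\<eta>\<close> between two points of \<open>\<gamma>\<close> starts and ends
  near \<open>w\<close>, hence it stays near a segment of \<open>w\<close>, and every vertex of that segment is near the part of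
  \<open>\<gamma>\<close> between the two points.
\<close>

lemma stable_in_if_Morse_words:
  assumes B: "finite_gen_set G B" and H: "H \<subseteq> carrier G" and M: "morse_gauge M"
    and Morse: "\<And>w. geodesic_word G A w \<Longrightarrow> word_elt G w \<in> H \<Longrightarrow>
      is_Morse (Cay G A) M {0..real (length w)} (word_path G A w)"
    and C: "\<And>w i. geodesic_word G A w \<Longrightarrow> word_elt G w \<in> H \<Longrightarrow> \<exists>h\<in>H. d (vertex w i) h \<le> C"
  shows "\<exists>M' k. morse_gauge M' \<and> k \<ge> 0 \<and> stable_in G B M' k H"
proof -
  interpret B: cayley G B by unfold_locales (rule B)
  obtain K1 where K1: "K1 \<ge> 1" "\<And>g h. g \<in> carrier G \<Longrightarrow> h \<in> carrier G \<Longrightarrow> B.d g h \<le> K1 * d g h"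
    using word_dist_lipschitz[OF B] by blast
  obtain K2 where K2: "K2 \<ge> 1" "\<And>g h. g \<in> carrier G \<Longrightarrow> h \<in> carrier G \<Longrightarrow> d g h \<le> K2 * B.d g h"
    using B.word_dist_lipschitz[OF gen] by blast
  define K where "K = max K1 K2"
  have K: "K \<ge> 1" using K1(1) by (simp add: K_def)
  have K_B: "B.d g h \<le> K * d g h" if "g \<in> carrier G" "h \<in> carrier G" for g h
    using K1(2)[OF that] mult_right_mono[of K1 K "d g h"] by (simp add: K_def)
  have K_A: "d g h \<le> K * B.d g h" if "g \<in> carrier G" "h \<in> carrier G" for g h
    using K2(2)[OF that] mult_right_mono[of K2 K "B.d g h"] by (simp add: K_def)
  define R where "R = M (1 * K) (K * (0 + 2) + 2 * K) + 1 + K"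
  define E where "E k c = M (k * K) (K * (c + 2) + 2 * R) + 1 + R" for k c
  define M' where "M' k c = K * (E k c + (3 * R + 3 * K)) + 2" for k c
  have "M (1 * K) (K * (0 + 2) + 2 * K) \<ge> 0" using M K unfolding morse_gauge_def by force
  then have R: "R \<ge> 0" using K by (simp add: R_def)
  have E: "E k c \<ge> 0" if "k \<ge> 1" "c \<ge> 0" for k c
  proof -
    have "1 \<le> k * K" using mult_mono[of 1 k 1 K] that K by simp
    then have "0 \<le> M (k * K) (K * (c + 2) + 2 * R)"
      using M that K R unfolding morse_gauge_def by force
    then show ?thesis using R by (simp add: E_def)
  qed
  have "morse_gauge M'" using E R K by (auto simp: morse_gauge_def M'_def)
  moreover have "0 \<le> K * (R + \<bar>C\<bar>) + 1" using R K by simp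
  moreover have "stable_in G B M' (K * (R + \<bar>C\<bar>) + 1) H"
    unfolding stable_in_def
  proof (intro ballI allI impI; elim conjE)
    fix h a b \<gamma>
    assume h: "h \<in> H" and ab: "(a::real) \<le> b" and geo: "geodesic (Cay G B) {a..b} \<gamma>"
      and start: "\<gamma> a = cay_vertex G B \<one>" and finish: "\<gamma> b = cay_vertex G B h"
    have \<gamma>: "quasi_geodesic (Cay G B) 1 0 {a..b} \<gamma>" using geo by (simp add: geodesic_def)
    have \<gamma>_in: "\<gamma> t \<in> mspace (Cay G B)" if "t \<in> {a..b}" for t using quasi_geodesicD(1)[OF \<gamma> that that] .
    have hG: "h \<in> carrier G" using h H by blast
    obtain w where w: "geodesic_word G A w" "word_elt G w = h" using geodesic_word_exists[OF hG] .
    have wA: "w \<in> lists A" using w(1) by (rule geodesic_word_lists)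
    have w_Morse: "is_Morse (Cay G A) M {0..real (length w)} (word_path G A w)"
      using Morse w h by simp
    define p where "p t = B.near_vertex (\<gamma> t)" for t
    have p: "vertex_quasi_geodesic (1 * K) (K * (0 + 2)) a b p"
      unfolding p_def by (rule quasi_geodesic_near_vertices[OF B.cayley_axioms K K_B K_A \<gamma>])
    have p_in: "p t \<in> carrier G" if "t \<in> {a..b}" for t
      using vertex_quasi_geodesicD(1)[OF p that that] .
    have end_near: "d (B.near_vertex (cay_vertex G B g)) g \<le> K" if "g \<in> carrier G" for g
    proof -
      let ?v = "B.near_vertex (cay_vertex G B g)"
      have v: "?v \<in> carrier G" "B.d ?v g \<le> 1"
        using B.near_vertex[of "cay_vertex G B g"] B.near_vertex_dist_vertex[of "cay_vertex G B g" g] that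
        by (simp_all add: B.cay_vertex_in B.mdist_vertices)
      have "d ?v g \<le> K * B.d ?v g" using K_A v that by simp
      also have "\<dots> \<le> K * 1" using v K by (intro mult_left_mono) auto
      finally show ?thesis by simp
    qed
    have "\<exists>l. l \<le> length w \<and> d (p t) (vertex w l) \<le> R" if t: "t \<in> {a..b}" for t
    proof -
      have par: "1 \<le> 1 * K" "0 \<le> K * (0 + 2)" "0 \<le> K" using K by auto
      have e: "d (p a) (vertex w 0) \<le> K" "d (p b) (vertex w (length w)) \<le> K"
        using end_near[of \<one>] end_near[OF hG] w by (simp_all add: p_def start finish)
      show ?thesis
        using Morse_word_vertices[OF wA w_Morse M _ _ par p e t] unfolding R_def by auto
    qed
    \<comment> \<open>The point \<open>\<gamma> t\<close> is near the vertex of \<open>w\<close> with index \<open>f t\<close>. The function \<open>f\<close> need not be monotone,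
      but it has bounded jumps.\<close>
    then obtain f where f: "\<And>t. t \<in> {a..b} \<Longrightarrow> f t \<le> length w"
      "\<And>t. t \<in> {a..b} \<Longrightarrow> d (p t) (vertex w (f t)) \<le> R" by metis
    have jump: "\<bar>real (f x) - real (f y)\<bar> \<le> 2 * R + 3 * K"
      if xy: "x \<in> {a..b}" "y \<in> {a..b}" "\<bar>x - y\<bar> \<le> 1" for x y
    proof -
      have "d (p x) (p y) \<le> 1 * K * \<bar>x - y\<bar> + K * (0 + 2)"
        by (rule vertex_quasi_geodesicD(3)[OF p xy(1,2)])
      also have "\<dots> \<le> 3 * K" using mult_left_mono[OF xy(3), of K] K by simp
      finally have "d (p x) (p y) \<le> 3 * K" .
      moreover have "\<bar>d (p x) (p y) - d (vertex w (f x)) (vertex w (f y))\<bar> \<le> 2 * R"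
        using f p_in xy wA by (intro d_perturb) auto
      ultimately show ?thesis using geodesic_vertices[OF w(1) f(1) f(1), OF xy(1,2)] by linarith
    qed
    have "is_Morse (Cay G B) M' {a..b} \<gamma>"
      unfolding is_Morse_def
    proof (intro allI impI; elim conjE; intro subsetI; elim imageE; hypsubst)
      fix s t k c a' b' \<eta> r
      assume st: "(s::real) \<le> t" "{s..t} \<subseteq> {a..b}" and \<eta>: "quasi_geodesic (Cay G B) k c {a'..b'} \<eta>"
        and ends: "\<eta> a' = \<gamma> s" "\<eta> b' = \<gamma> t" and r: "r \<in> {a'..b'}"
      have kc: "k \<ge> 1" "c \<ge> 0" using \<eta> by (simp_all add: quasi_geodesic_def)
      have st_in: "s \<in> {a..b}" "t \<in> {a..b}" using st by auto
      define q where "q x = B.near_vertex (\<eta> x)" for x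
      have q: "vertex_quasi_geodesic (k * K) (K * (c + 2)) a' b' q"
        unfolding q_def by (rule quasi_geodesic_near_vertices[OF B.cayley_axioms K K_B K_A \<eta>])
      have par: "1 \<le> k * K" "0 \<le> K * (c + 2)" using mult_mono[of 1 k 1 K] kc K by auto
      have e: "d (q a') (vertex w (f s)) \<le> R" "d (q b') (vertex w (f t)) \<le> R"
        using f(2)[OF st_in(1)] f(2)[OF st_in(2)] by (simp_all add: q_def p_def ends)
      obtain l where l: "min (f s) (f t) \<le> l" "l \<le> max (f s) (f t)" "d (q r) (vertex w l) \<le> E k c"
        using Morse_word_vertices_symmetric[OF wA w_Morse M f(1)[OF st_in(1)] f(1)[OF st_in(2)] par R q e r]
        unfolding E_def by blast
      have lw: "l \<le> length w" using l(2) f(1)[OF st_in(1)] f(1)[OF st_in(2)] by simp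
      obtain x where x: "x \<in> {s..t}" "\<bar>real (f x) - real l\<bar> \<le> 2 * R + 3 * K"
        by (rule coarse_intermediate_value[of s t "\<lambda>x. real (f x)" "2 * R + 3 * K" "real l"])
          (use st jump l in \<open>auto simp: subset_iff\<close>)
      have x_in: "x \<in> {a..b}" using x(1) st by blast
      have q_r: "q r \<in> carrier G" using vertex_quasi_geodesicD(1)[OF q r r] .
      have "d (vertex w l) (vertex w (f x)) \<le> 2 * R + 3 * K"
        using geodesic_vertices[OF w(1) lw f(1)[OF x_in]] x(2) by linarith
      moreover have "d (q r) (p x) \<le> d (q r) (vertex w l) + d (vertex w l) (vertex w (f x)) + d (vertex w (f x)) (p x)"
        using d_triangle[of "q r" "vertex w l" "p x"] d_triangle[of "vertex w l" "vertex w (f x)" "p x"]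
          q_r p_in[OF x_in] wA by simp
      ultimately have "d (q r) (p x) \<le> E k c + (3 * R + 3 * K)"
        using l(3) f(2)[OF x_in] d_commute[of "p x" "vertex w (f x)"] p_in[OF x_in] wA by simp
      then have "K * d (q r) (p x) \<le> K * (E k c + (3 * R + 3 * K))"
        using K by (intro mult_left_mono) auto
      moreover have \<eta>_in: "\<eta> r \<in> mspace (Cay G B)" using quasi_geodesicD(1)[OF \<eta> r r] .
      ultimately have "mdist (Cay G B) (\<eta> r) (\<gamma> x) \<le> M' k c"
        using B.near_vertex_dist[OF \<eta>_in \<gamma>_in[OF x_in]] K_B[OF q_r p_in[OF x_in]]
        unfolding M'_def q_def p_def by linarith
      then show "\<eta> r \<in> nbhd (Cay G B) (M' k c) (\<gamma> ` {s..t})"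
        using \<eta>_in x(1) unfolding nbhd_def by blast
    qed
    moreover have "\<gamma> t \<in> nbhd (Cay G B) (K * (R + \<bar>C\<bar>) + 1) (cay_vertex G B ` H)" if t: "t \<in> {a..b}" for t
    proof -
      obtain h' where h': "h' \<in> H" "d (vertex w (f t)) h' \<le> C" using C[of w "f t"] w h by auto
      have hG': "h' \<in> carrier G" using h' H by blast
      have "d (p t) h' \<le> d (p t) (vertex w (f t)) + d (vertex w (f t)) h'"
        using p_in[OF t] hG' wA by (simp add: d_triangle)
      then have "d (p t) h' \<le> R + \<bar>C\<bar>" using f(2)[OF t] h'(2) by linarith
      then have "K * d (p t) h' \<le> K * (R + \<bar>C\<bar>)" using K by (intro mult_left_mono) auto
      then have "mdist (Cay G B) (\<gamma> t) (cay_vertex G B h') \<le> K * (R + \<bar>C\<bar>) + 1"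
        using B.near_vertex_dist_vertex[OF \<gamma>_in[OF t] hG'] K_B[OF p_in[OF t] hG']
        unfolding p_def by linarith
      then show ?thesis using \<gamma>_in[OF t] h'(1) unfolding nbhd_def by blast
    qed
    ultimately show "is_Morse (Cay G B) M' {a..b} \<gamma> \<and>
        \<gamma> ` {a..b} \<subseteq> nbhd (Cay G B) (K * (R + \<bar>C\<bar>) + 1) (cay_vertex G B ` H)" by blast
  qed
  ultimately show ?thesis by blast
qed

end

section \<open>Residuals of the geodesic language of a stable subgroup\<close>

context cayley
begin

text \<open>
  The graph of the function \<open>x \<mapsto> |g x| - |g|\<close> on a ball, where \<open>g\<close> is the endpoint of \<open>w\<close>. As a subset of
  a finite set of pairs it takes only finitely many values.
\<close>

definition level :: "real \<Rightarrow> 'g list \<Rightarrow> ('g \<times> int) set" where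
  "level r w = (\<lambda>x. (x, int (word_length G A (word_elt G w \<otimes> x)) - int (word_length G A (word_elt G w)))) ` ball r"

definition subgroup_offset :: "'g set \<Rightarrow> real \<Rightarrow> 'g list \<Rightarrow> 'g set" where
  "subgroup_offset H r w = {x \<in> ball r. word_elt G w \<otimes> inv x \<in> H}"

lemma finite_levels: "finite (level r ` lists A)"
proof (rule finite_subset)
  show "level r ` lists A \<subseteq> Pow (ball r \<times> {- \<lceil>r\<rceil>..\<lceil>r\<rceil>})"
  proof (intro subsetI PowI; elim imageE; hypsubst)
    fix w y assume w: "w \<in> lists A" and "y \<in> level r w"
    then obtain x where x: "x \<in> ball r"
      "y = (x, int (word_length G A (word_elt G w \<otimes> x)) - int (word_length G A (word_elt G w)))"
      unfolding level_def by blast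
    let ?g = "word_elt G w"
    have c: "?g \<in> carrier G" "x \<in> carrier G" "d \<one> x \<le> r" using x(1) w by (auto simp: ball_def)
    have "d ?g (?g \<otimes> x) = d \<one> x" using d_left_mult[of ?g \<one> x] c by simp
    then have "\<bar>d \<one> (?g \<otimes> x) - d \<one> ?g\<bar> \<le> r"
      using d_triangle[of \<one> ?g "?g \<otimes> x"] d_triangle[of \<one> "?g \<otimes> x" ?g]
        d_commute[of ?g "?g \<otimes> x"] c by simp
    then have "\<bar>int (word_length G A (?g \<otimes> x)) - int (word_length G A ?g)\<bar> \<le> \<lceil>r\<rceil>"
      using c by (simp add: d_one) linarith
    then show "y \<in> ball r \<times> {- \<lceil>r\<rceil>..\<lceil>r\<rceil>}" using x by auto
  qed
  show "finite (Pow (ball r \<times> {- \<lceil>r\<rceil>..\<lceil>r\<rceil>}))" using finite_ball by simp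
qed

lemma level_eqD:
  assumes "level r w = level r w'" "x \<in> ball r"
  shows "int (word_length G A (word_elt G w \<otimes> x)) - int (word_length G A (word_elt G w)) =
    int (word_length G A (word_elt G w' \<otimes> x)) - int (word_length G A (word_elt G w'))"
proof -
  have "(x, int (word_length G A (word_elt G w \<otimes> x)) - int (word_length G A (word_elt G w))) \<in> level r w'"
    using assms unfolding level_def by blast
  then show ?thesis unfolding level_def by blast
qed

context
  fixes H :: "'g set" and M :: "real \<Rightarrow> real \<Rightarrow> real" and k :: real
  assumes H: "subgroup H G" and M: "morse_gauge M" and k: "k \<ge> 0" and stable: "stable_in G A M k H"
begin

lemma H_carrier: "h \<in> H \<Longrightarrow> h \<in> carrier G"
  using subgroup.mem_carrier[OF H] .

lemma
  assumes "geodesic_word G A w" "word_elt G w \<in> H"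
  shows stable_word_Morse: "is_Morse (Cay G A) M {0..real (length w)} (word_path G A w)"
    and stable_word_image: "word_path G A w ` {0..real (length w)} \<subseteq> nbhd (Cay G A) k (cay_vertex G A ` H)"
proof -
  have w: "w \<in> lists A" using assms(1) by (rule geodesic_word_lists)
  have "geodesic (Cay G A) {0..real (length w)} (word_path G A w)"
    using assms(1) by (simp add: geodesic_word_def)
  moreover have "word_path G A w 0 = cay_vertex G A \<one>"
    "word_path G A w (real (length w)) = cay_vertex G A (word_elt G w)"
    using word_path_nat[OF w, of 0] word_path_nat[OF w, of "length w"] by simp_all
  ultimately show "is_Morse (Cay G A) M {0..real (length w)} (word_path G A w)"
    "word_path G A w ` {0..real (length w)} \<subseteq> nbhd (Cay G A) k (cay_vertex G A ` H)"
    using stable assms(2) unfolding stable_in_def by (metis of_nat_0_le_iff)+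
qed

lemma stable_vertex_near:
  assumes w: "geodesic_word G A w" "word_elt G w \<in> H"
  obtains h where "h \<in> H" "d (vertex w i) h \<le> k"
proof -
  have wA: "w \<in> lists A" using w(1) by (rule geodesic_word_lists)
  define j where "j = min i (length w)"
  have "vertex w j = vertex w i" by (simp add: j_def min_def)
  moreover have "word_path G A w (real j) \<in> nbhd (Cay G A) k (cay_vertex G A ` H)"
    using stable_word_image[OF w] by (auto simp: j_def)
  ultimately have "cay_vertex G A (vertex w i) \<in> nbhd (Cay G A) k (cay_vertex G A ` H)"
    using word_path_nat[OF wA, of j] by (simp add: j_def)
  then obtain h where "h \<in> H" "mdist (Cay G A) (cay_vertex G A (vertex w i)) (cay_vertex G A h) \<le> k"
    unfolding nbhd_def by auto
  then show ?thesis using that wA H_carrier by (simp add: mdist_vertices)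
qed

text \<open>
  Twice the constant of \<open>almost_geodesic_near_Morse_word\<close> for \<open>D = k\<close>.
\<close>

definition fellow_const :: real where
  "fellow_const = 2 * (2 * (M 1 (3 + 2 * k) + 1 + k) + 2)"

text \<open>
  The common endpoint need not lie in \<open>H\<close>: both words follow the same Morse geodesic to the nearby
  element \<open>h\<close> of \<open>H\<close>.
\<close>

lemma fellow_travel:
  assumes "almost_geodesic v" "almost_geodesic w" "word_elt G v = word_elt G w"
    and h: "h \<in> H" "d (word_elt G w) h \<le> k" and i: "i \<le> length v" "i \<le> length w"
  shows "d (vertex v i) (vertex w i) \<le> fellow_const"
proof -
  have vw: "v \<in> lists A" "w \<in> lists A" using assms(1,2) by (simp_all add: almost_geodesic_def)
  obtain z where z: "geodesic_word G A z" "word_elt G z = h"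
    using geodesic_word_exists[OF H_carrier[OF h(1)]] .
  have zA: "z \<in> lists A" using z(1) by (rule geodesic_word_lists)
  have "is_Morse (Cay G A) M {0..real (length z)} (word_path G A z)"
    using stable_word_Morse z h by simp
  from almost_geodesic_near_Morse_word[OF assms(1) z(1) this M _ i(1), of k]
    almost_geodesic_near_Morse_word[OF assms(2) z(1) this M _ i(2), of k]
  have "d (vertex v i) (vertex z i) \<le> fellow_const / 2" "d (vertex w i) (vertex z i) \<le> fellow_const / 2"
    using assms(3) h z by (simp_all add: fellow_const_def)
  then show ?thesis
    using d_triangle[of "vertex v i" "vertex z i" "vertex w i"] d_commute[of "vertex w i" "vertex z i"]
      vw zA by simp
qed

text \<open>
  The element \<open>x = h\<^sup>-\<^sup>1 g\<close>, where \<open>g\<close> is the endpoint of \<open>w\<close>, belongs to both sets. So \<open>g = h x\<close>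
  and \<open>g' = h' x\<close> with \<open>h' \<in> H\<close>, and \<open>g' g\<^sup>-\<^sup>1 = h' h\<^sup>-\<^sup>1\<close>.
\<close>

lemma subgroup_offset_eqD:
  assumes w: "w \<in> lists A" "w' \<in> lists A" and eq: "subgroup_offset H k w = subgroup_offset H k w'"
    and h: "h \<in> H" "d (word_elt G w) h \<le> k"
  shows "word_elt G w' \<otimes> inv (word_elt G w) \<in> H"
proof -
  interpret H: subgroup H G by (rule H)
  let ?g = "word_elt G w" and ?g' = "word_elt G w'"
  have c: "?g \<in> carrier G" "?g' \<in> carrier G" "h \<in> carrier G" using w h H_carrier by auto
  define x where "x = inv h \<otimes> ?g"
  have x: "x \<in> carrier G" using c by (simp add: x_def)
  have "d \<one> x = d h ?g" using d_left_mult[of "inv h" h ?g] c by (simp add: x_def)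
  moreover have gx: "?g \<otimes> inv x = h" using c by (simp add: x_def inv_mult_group flip: m_assoc)
  ultimately have "x \<in> subgroup_offset H k w"
    using h x d_commute[of h ?g] c by (simp add: subgroup_offset_def ball_def)
  then have "?g' \<otimes> inv x \<in> H" unfolding eq by (simp add: subgroup_offset_def)
  then have "(?g' \<otimes> inv x) \<otimes> inv (?g \<otimes> inv x) \<in> H" using gx h by simp
  moreover have "(?g' \<otimes> inv x) \<otimes> inv (?g \<otimes> inv x) = ?g' \<otimes> inv ?g"
  proof -
    have "(?g' \<otimes> inv x) \<otimes> inv (?g \<otimes> inv x) = ?g' \<otimes> (inv x \<otimes> x \<otimes> inv ?g)"
      using c x by (simp only: inv_mult_group inv_inv inv_closed m_assoc m_closed)
    then show ?thesis using c x by simp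
  qed
  ultimately show ?thesis by simp
qed

text \<open>
  By induction, every word \<open>w' v\<close> with \<open>v\<close> a prefix of \<open>u\<close> is geodesic: it is almost geodesic, and the
  level data exclude a shorter word \<open>z\<close> with the same endpoint. The radius is \<open>fellow_const + 1\<close> because
  \<open>z\<close> may have one letter less than \<open>w'\<close>, in which case the two are compared at the index
  \<open>length w' - 1\<close>, one step before the endpoint of \<open>w'\<close>.
\<close>

lemma continuation_transfer:
  assumes w: "geodesic_word G A w" and w': "geodesic_word G A w'" and u: "u \<in> lists A"
    and level: "level (fellow_const + 1) w = level (fellow_const + 1) w'"
    and offset: "subgroup_offset H k w = subgroup_offset H k w'"
    and wu: "w @ u \<in> geodesic_language G A H"
  shows "w' @ u \<in> geodesic_language G A H"
proof -
  interpret H: subgroup H G by (rule H)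
  let ?g = "word_elt G w" and ?g' = "word_elt G w'"
  have A: "w \<in> lists A" "w' \<in> lists A" "w @ u \<in> lists A" using w w' u geodesic_word_lists by auto
  have wu': "geodesic_word G A (w @ u)" "word_elt G (w @ u) \<in> H"
    using wu by (simp_all add: geodesic_language_def)
  have c: "?g \<in> carrier G" "?g' \<in> carrier G" using A by simp_all
  define T where "T = ?g' \<otimes> inv ?g"
  obtain h0 where "h0 \<in> H" "d ?g h0 \<le> k" using stable_vertex_near[OF wu', of "length w"] by auto
  then have TH: "T \<in> H" unfolding T_def by (rule subgroup_offset_eqD[OF A(1,2) offset])
  have T: "T \<in> carrier G" using H_carrier[OF TH] .
  have T_elt: "word_elt G (w' @ v) = T \<otimes> word_elt G (w @ v)" if "v \<in> lists A" for v
  proof -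
    have "T \<otimes> (?g \<otimes> word_elt G v) = (T \<otimes> ?g) \<otimes> word_elt G v" using T c that by (simp add: m_assoc)
    also have "T \<otimes> ?g = ?g'" unfolding T_def using c by (simp add: m_assoc)
    finally show ?thesis using A that by (simp add: elt_append)
  qed
  have "geodesic_word G A (w' @ take j u)" if "j \<le> length u" for j
    using that
  proof (induction j)
    case (Suc j)
    define v where "v = take (Suc j) u"
    have v: "v \<in> lists A" "length v = Suc j" using u Suc.prems by (simp_all add: v_def)
    have "butlast (w' @ v) = w' @ take j u" using v(2) Suc.prems by (auto simp: butlast_append v_def butlast_take)
    then have almost: "almost_geodesic (w' @ v)"
      using Suc A v(1) by (simp add: almost_geodesic_def)
    have wv: "take (length w + Suc j) (w @ u) = w @ v" by (simp add: v_def)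
    have wv_geo: "geodesic_word G A (w @ v)"
      using geodesic_word_take[OF wu'(1), of "length w + Suc j"] unfolding wv .
    obtain h where h: "h \<in> H" "d (word_elt G (w @ v)) h \<le> k"
      using stable_vertex_near[OF wu', of "length w + Suc j"] unfolding wv by blast
    let ?e = "word_elt G (w @ v)" and ?e' = "word_elt G (w' @ v)"
    have e: "?e \<in> carrier G" "?e' \<in> carrier G" using A v(1) by (auto simp: elt_append)
    have e': "?e' = T \<otimes> ?e" by (rule T_elt[OF v(1)])
    have h': "T \<otimes> h \<in> H" "d ?e' (T \<otimes> h) \<le> k"
      using TH h d_left_mult[OF T e(1), of h] H_carrier e' by auto
    obtain z where z: "geodesic_word G A z" "word_elt G z = ?e'" using geodesic_word_exists[OF e(2)] .
    have zA: "z \<in> lists A" using z(1) by (rule geodesic_word_lists)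
    have z_len: "d \<one> ?e' = real (length z)" using geodesic_word_d[OF z(1)] z(2) by simp
    define i where "i = min (length w') (length z)"
    have "real (length (w' @ v)) - 2 \<le> d \<one> ?e'"
      using almost_geodesic_lower[OF almost, of 0 "length (w' @ v)"] by simp
    then have i: "i \<le> length w'" "i \<le> length z" "length w' \<le> i + 1"
      using z_len v(2) by (auto simp: i_def)
    have w'v: "w' @ v \<in> lists A" using A v(1) by simp
    have "d (vertex (w' @ v) i) (vertex z i) \<le> fellow_const"
      by (rule fellow_travel[OF almost geodesic_imp_almost[OF z(1)]]) (use z h' i in auto)
    moreover have "vertex (w' @ v) i = vertex w' i" using i(1) by simp
    moreover have "d (vertex w' i) ?g' \<le> 1"
      using d_vertices_le[OF A(2) i(1)] i(3) by simp
    moreover have "d ?g' (vertex z i) \<le> d ?g' (vertex w' i) + d (vertex w' i) (vertex z i)"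
      using A zA by (simp add: d_triangle)
    ultimately have near: "d ?g' (vertex z i) \<le> fellow_const + 1"
      using d_commute[of "vertex w' i" ?g'] A by simp
    \<comment> \<open>The geodesic \<open>z\<close> passes through \<open>g' x\<close>. The level data determine the distance of \<open>g x\<close> from the
      identity, and \<open>inv T\<close> carries the rest of \<open>z\<close> to a path from \<open>g x\<close> to the endpoint of \<open>w v\<close>.\<close>
    define x where "x = inv ?g' \<otimes> vertex z i"
    have x: "x \<in> carrier G" using c zA by (simp add: x_def)
    have g'x: "?g' \<otimes> x = vertex z i" using c zA by (simp add: x_def flip: m_assoc)
    have "d \<one> x = d ?g' (vertex z i)" using d_left_mult[of ?g' \<one> x] c x g'x by simp
    then have "x \<in> ball (fellow_const + 1)" using near x by (simp add: ball_def)
    from level_eqD[OF level this]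
    have "int (word_length G A (?g \<otimes> x)) - int (length w) = int i - int (length w')"
      using geodesic_word_take[OF z(1), of i] w w' i(2) by (simp add: g'x geodesic_word_iff)
    then have len_x: "d \<one> (?g \<otimes> x) = real i - real (length w') + real (length w)"
      using c x by (simp add: d_one)
    have "?g \<otimes> x = inv T \<otimes> vertex z i"
    proof -
      have "inv T \<otimes> vertex z i = ?g \<otimes> inv ?g' \<otimes> (?g' \<otimes> x)" using c by (simp add: g'x T_def inv_mult_group)
      also have "\<dots> = ?g \<otimes> (inv ?g' \<otimes> ?g' \<otimes> x)" using c x by (simp only: m_assoc inv_closed m_closed)
      finally show ?thesis using c x by simp
    qed
    moreover have "?e = inv T \<otimes> ?e'" using e e' T by (simp flip: m_assoc)
    ultimately have "d (?g \<otimes> x) ?e = d (vertex z i) ?e'"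
      using d_left_mult[of "inv T" "vertex z i" ?e'] T zA e by simp
    also have "\<dots> = real (length z) - real i"
      using geodesic_vertices[OF z(1) i(2), of "length z"] z(2) i(2) by simp
    finally have "d \<one> ?e \<le> real (length w) + real (length z) - real (length w')"
      using d_triangle[of \<one> "?g \<otimes> x" ?e] c x e len_x by simp
    moreover have "d \<one> ?e = real (length w) + real (length v)"
      using geodesic_word_d[OF wv_geo] by simp
    ultimately have "real (length (w' @ v)) \<le> d \<one> ?e'" using z_len by simp
    then have "word_length G A ?e' = length (w' @ v)"
      using word_length_le[OF group_axioms gen w'v] e by (simp add: d_one)
    then show ?case using w'v unfolding v_def[symmetric] by (simp add: geodesic_word_iff)
  qed (use w' in simp)
  from this[of "length u"] have "geodesic_word G A (w' @ u)" by simp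
  moreover have "word_elt G (w' @ u) \<in> H" using T_elt[OF u] TH wu'(2) by simp
  ultimately show ?thesis by (simp add: geodesic_language_def)
qed

text \<open>
  All words that are not prefixes of words of the language have the same residual, the empty set,
  whatever their endpoints are.
\<close>

definition residual_data :: "'g list \<Rightarrow> (('g \<times> int) set \<times> 'g set) option" where
  "residual_data w =
     (if \<exists>u\<in>lists A. w @ u \<in> geodesic_language G A H
      then Some (level (fellow_const + 1) w, subgroup_offset H k w) else None)"

lemma finite_residual_data: "finite (residual_data ` lists A)"
proof (rule finite_subset)
  show "residual_data ` lists A \<subseteq>
      insert None (Some ` (level (fellow_const + 1) ` lists A \<times> Pow (ball k)))"
    by (auto simp: residual_data_def subgroup_offset_def)
  show "finite (insert None (Some ` (level (fellow_const + 1) ` lists A \<times> Pow (ball k))))"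
    using finite_levels finite_ball by simp
qed

lemma residual_data_eqD:
  assumes "u \<in> lists A" "residual_data w = residual_data w'" "w @ u \<in> geodesic_language G A H"
  shows "w' @ u \<in> geodesic_language G A H"
proof -
  have geo: "geodesic_word G A w" if "w @ v \<in> geodesic_language G A H" for w v
    using geodesic_word_take[of "w @ v" "length w"] that by (simp add: geodesic_language_def)
  have "residual_data w = Some (level (fellow_const + 1) w, subgroup_offset H k w)"
    using assms(1,3) by (auto simp: residual_data_def)
  then have "residual_data w' = Some (level (fellow_const + 1) w, subgroup_offset H k w)"
    using assms(2) by simp
  then obtain v where "w' @ v \<in> geodesic_language G A H"
    "level (fellow_const + 1) w = level (fellow_const + 1) w'"
    "subgroup_offset H k w = subgroup_offset H k w'"
    unfolding residual_data_def by (auto split: if_splits)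
  then show ?thesis using continuation_transfer[OF geo geo assms(1)] assms(3) by blast
qed

lemma geodesic_language_lists: "geodesic_language G A H \<subseteq> lists A"
  using geodesic_word_lists by (auto simp: geodesic_language_def)

lemma regular_geodesic_language: "regular_language A (geodesic_language G A H)"
  using geodesic_language_lists finite_residual_data
  by (rule regular_language_if_finite_index) (rule residual_data_eqD)

section \<open>Lexicographically least words\<close>

text \<open>
  As \<open>lex R\<close> only relates words of the same length, every competitor \<open>v\<close> is a geodesic word as well.
\<close>

definition lex_least_language :: "('g \<times> 'g) set \<Rightarrow> 'g list set" where
  "lex_least_language R = {w \<in> geodesic_language G A H.
     \<not> (\<exists>v\<in>lists A. (v, w) \<in> lex R \<and> word_elt G v = word_elt G w)}"

text \<open>The words \<open>v\<close> have the length of \<open>w\<close>, but they need not be geodesic.\<close>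

definition lex_smaller :: "('g \<times> 'g) set \<Rightarrow> real \<Rightarrow> 'g list \<Rightarrow> 'g set" where
  "lex_smaller R r w = {x \<in> ball r. \<exists>v\<in>lists A. (v, w) \<in> lex R \<and> word_elt G v = word_elt G w \<otimes> x}"

lemma same_length_geodesic:
  assumes "w \<in> geodesic_language G A H" "v \<in> lists A" "length v = length w" "word_elt G v = word_elt G w"
  shows "v \<in> geodesic_language G A H"
  using assms by (auto simp: geodesic_language_def geodesic_word_iff)

text \<open>
  Let \<open>v\<close> be smaller than \<open>w' u\<close> with the same endpoint, and cut it at the length of \<open>w'\<close> into \<open>v1\<close> and \<open>v2\<close>.
  If \<open>v1\<close> and \<open>w'\<close> differ, then \<open>v1\<close> is smaller and, as geodesics with common ends in \<open>H\<close> stay close,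
  its endpoint \<open>g' x\<close> is near \<open>g'\<close>. The same data of \<open>w\<close> provide a word \<open>y\<close> smaller than \<open>w\<close> that ends at
  \<open>g x\<close>, and \<open>y v2\<close> is smaller than \<open>w u\<close> with the same endpoint.
\<close>

lemma regular_lex_least_language: "regular_language A (lex_least_language R)"
proof (rule regular_language_if_finite_index)
  show "lex_least_language R \<subseteq> lists A"
    using geodesic_language_lists by (auto simp: lex_least_language_def)
  let ?f = "\<lambda>w. (residual_data w, lex_smaller R fellow_const w)"
  show "finite (?f ` lists A)"
  proof (rule finite_subset)
    show "?f ` lists A \<subseteq> residual_data ` lists A \<times> Pow (ball fellow_const)"
      by (auto simp: lex_smaller_def)
    show "finite (residual_data ` lists A \<times> Pow (ball fellow_const))"
      using finite_residual_data finite_ball by simp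
  qed
  fix w w' u
  assume A: "w \<in> lists A" "w' \<in> lists A" "u \<in> lists A" and f: "?f w = ?f w'"
    and wu: "w @ u \<in> lex_least_language R"
  let ?L = "geodesic_language G A H" and ?g = "word_elt G w" and ?g' = "word_elt G w'"
  have least: "w @ u \<in> ?L" "\<And>v. v \<in> lists A \<Longrightarrow> (v, w @ u) \<in> lex R \<Longrightarrow> word_elt G v \<noteq> word_elt G (w @ u)"
    using wu by (auto simp: lex_least_language_def)
  have w'u: "w' @ u \<in> ?L" using residual_data_eqD[OF A(3) _ least(1)] f by simp
  have "False" if v: "v \<in> lists A" "(v, w' @ u) \<in> lex R" "word_elt G v = word_elt G (w' @ u)" for v
  proof -
    have vL: "v \<in> ?L" using same_length_geodesic[OF w'u v(1) lex_length[OF v(2)] v(3)] .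
    define v1 v2 where "v1 = take (length w') v" and "v2 = drop (length w') v"
    have vv: "v = v1 @ v2" "length v1 = length w'" "v1 \<in> lists A" "v2 \<in> lists A"
      using v(1) lex_length[OF v(2)] by (simp_all add: v1_def v2_def del: in_lists_conv_set)
    have len2: "length v2 = length u" using lex_length[OF v(2)] vv(1,2) by simp
    have c: "?g \<in> carrier G" "?g' \<in> carrier G" "word_elt G u \<in> carrier G"
      "word_elt G v1 \<in> carrier G" "word_elt G v2 \<in> carrier G" using A vv by simp_all
    have elt: "word_elt G v1 \<otimes> word_elt G v2 = ?g' \<otimes> word_elt G u"
      using v(3) A vv by (simp add: elt_append del: in_lists_conv_set)
    from lex_append_cases[OF vv(2)] v(2) vv(1)
    consider "(v1, w') \<in> lex R" | "v1 = w'" "(v2, u) \<in> lex R" by blast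
    then show False
    proof cases
      case 1
      define x where "x = inv ?g' \<otimes> word_elt G v1"
      have x: "x \<in> carrier G" using c by (simp add: x_def)
      have g'x: "word_elt G v1 = ?g' \<otimes> x" using c by (simp add: x_def flip: m_assoc)
      have "d (vertex (w' @ u) (length w')) (vertex v (length w')) \<le> fellow_const"
      proof (rule fellow_travel)
        show "almost_geodesic (w' @ u)" "almost_geodesic v"
          using w'u vL by (auto simp: geodesic_language_def intro: geodesic_imp_almost)
        show "word_elt G v \<in> H" using vL by (simp add: geodesic_language_def)
        show "d (word_elt G v) (word_elt G v) \<le> k" using k v(1) by simp
      qed (use v lex_length[OF v(2)] in auto)
      moreover have "vertex v (length w') = ?g' \<otimes> x" using g'x by (simp add: v1_def)
      ultimately have "d \<one> x \<le> fellow_const" using d_left_mult[of ?g' \<one> x] c x by simp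
      then have "x \<in> lex_smaller R fellow_const w'"
        using 1 vv(3) x g'x by (auto simp: lex_smaller_def ball_def)
      then have "x \<in> lex_smaller R fellow_const w" using f by simp
      then obtain y where y: "y \<in> lists A" "(y, w) \<in> lex R" "word_elt G y = ?g \<otimes> x"
        unfolding lex_smaller_def by blast
      have "?g' \<otimes> (x \<otimes> word_elt G v2) = ?g' \<otimes> word_elt G u"
        using elt c x unfolding g'x by (simp add: m_assoc)
      then have "x \<otimes> word_elt G v2 = word_elt G u" using c x by simp
      then have "word_elt G (y @ v2) = word_elt G (w @ u)"
        using A y vv c x by (simp add: elt_append m_assoc del: in_lists_conv_set)
      moreover have "(y @ v2, w @ u) \<in> lex R" using y(2) len2 by (simp add: lex_append_rightI)
      ultimately show False using least(2)[of "y @ v2"] y(1) vv(4) by simp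
    next
      case 2
      then have "word_elt G v2 = word_elt G u" using elt c by simp
      then have "word_elt G (w @ v2) = word_elt G (w @ u)"
        using A vv by (simp add: elt_append del: in_lists_conv_set)
      moreover have "(w @ v2, w @ u) \<in> lex R" using 2(2) by (rule lex_append_leftI)
      ultimately show False using least(2)[of "w @ v2"] A vv(4) by simp
    qed
  qed
  then show "w' @ u \<in> lex_least_language R" using w'u unfolding lex_least_language_def by blast
qed

lemma lex_least_unique:
  assumes R: "wf R" "total_on A R" and h: "h \<in> H"
  shows "\<exists>!w. w \<in> lex_least_language R \<and> word_elt G w = h"
proof -
  let ?W = "{w \<in> geodesic_language G A H. word_elt G w = h}"
  obtain w0 where "w0 \<in> ?W"
    using geodesic_word_exists[OF H_carrier[OF h]] h by (auto simp: geodesic_language_def)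
  then obtain w where w: "w \<in> ?W" "\<And>v. (v, w) \<in> lex R \<Longrightarrow> v \<notin> ?W"
    by (rule wfE_min[OF wf_lex[OF R(1)]]) (rule that)
  have "v \<in> ?W" if "v \<in> lists A" "(v, w) \<in> lex R" "word_elt G v = word_elt G w" for v
    using same_length_geodesic[of w v] w(1) that lex_length[OF that(2)] by simp
  then have "w \<in> lex_least_language R" using w by (auto simp: lex_least_language_def)
  moreover have "v = w"
    if v: "v \<in> lex_least_language R" "word_elt G v = h" for v
  proof -
    have vw: "v \<in> geodesic_language G A H" "w \<in> geodesic_language G A H" "word_elt G w = h"
      using v w by (simp_all add: lex_least_language_def)
    then have A: "v \<in> lists A" "w \<in> lists A" "length v = length w"
      using v(2) geodesic_language_lists by (auto simp: geodesic_language_def geodesic_word_iff)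
    show ?thesis
      using lex_total_on[OF R(2) A(3,1,2)] v \<open>w \<in> lex_least_language R\<close> A vw
      unfolding lex_least_language_def by auto
  qed
  ultimately show ?thesis using w(1) by blast
qed

end

section \<open>Stability and regularity\<close>

text \<open>
  A prefix of a word of the language can be completed by a bounded number of letters to a word of the
  language, so it ends at a bounded distance from \<open>H\<close>.
\<close>

lemma stable_if_regular:
  assumes H: "subgroup H G" and reg: "regular_language A (geodesic_language G A H)"
    and M: "morse_gauge M" and Morse: "\<And>w. w \<in> geodesic_language G A H \<Longrightarrow> Morse_geodesic_word G A M w"
  shows "stable_subgroup G H"
  unfolding stable_subgroup_def
proof (intro allI impI)
  fix B assume B: "finite_gen_set G B"
  obtain C where C: "\<And>w i. w \<in> geodesic_language G A H \<Longrightarrow>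
      \<exists>u\<in>lists A. length u \<le> C \<and> take i w @ u \<in> geodesic_language G A H"
    using regular_language_completion_bound[OF reg] by blast
  show "\<exists>M k. morse_gauge M \<and> 0 \<le> k \<and> stable_in G B M k H"
  proof (rule stable_in_if_Morse_words[OF B subgroup.subset[OF H] M])
    fix w assume w: "geodesic_word G A w" "word_elt G w \<in> H"
    then have wL: "w \<in> geodesic_language G A H" by (simp add: geodesic_language_def)
    from Morse[OF this] show "is_Morse (Cay G A) M {0..real (length w)} (word_path G A w)"
      by (simp add: Morse_geodesic_word_def)
    fix i
    obtain u where u: "u \<in> lists A" "length u \<le> C" "take i w @ u \<in> geodesic_language G A H"
      using C[OF wL] by blast
    have "d (vertex w i) (word_elt G (take i w @ u)) \<le> real (length u)"
      using d_append[of "take i w" u] geodesic_word_lists[OF w(1)] u(1) by simp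
    then have "d (vertex w i) (word_elt G (take i w @ u)) \<le> real C" using u(2) by simp
    then show "\<exists>h\<in>H. d (vertex w i) h \<le> real C"
      using u(3) by (auto simp: geodesic_language_def)
  qed
qed

end

theorem theorem5:
  fixes G :: "('g, 'b) monoid_scheme" and A H :: "'g set"
  assumes "Morse_local_to_global_group G" and "finite_gen_set G A" and "subgroup H G"
  shows "(stable_subgroup G H \<longleftrightarrow>
            regular_language A (geodesic_language G A H) \<and>
            (\<exists>M. morse_gauge M \<and> (\<forall>w \<in> geodesic_language G A H. Morse_geodesic_word G A M w))) \<and>
         (stable_subgroup G H \<longrightarrow>
            (\<exists>J. J \<subseteq> geodesic_language G A H \<and> regular_language A J \<and>
                 (\<forall>h\<in>H. \<exists>!w. w \<in> J \<and> word_elt G w = h)))"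
proof -
  interpret group G using assms(1) by (simp add: Morse_local_to_global_group_def)
  interpret cayley G A by unfold_locales (rule assms(2))
  let ?L = "geodesic_language G A H"
  have "regular_language A ?L \<and> (\<exists>M. morse_gauge M \<and> (\<forall>w\<in>?L. Morse_geodesic_word G A M w)) \<and>
      (\<exists>J. J \<subseteq> ?L \<and> regular_language A J \<and> (\<forall>h\<in>H. \<exists>!w. w \<in> J \<and> word_elt G w = h))"
    if stable: "stable_subgroup G H"
  proof -
    obtain M k where Mk: "morse_gauge M" "k \<ge> 0" "stable_in G A M k H"
      using stable assms(2) unfolding stable_subgroup_def by blast
    note H = assms(3) Mk
    obtain idx :: "'g \<Rightarrow> nat" where idx: "inj_on idx A"
      using finite_imp_inj_to_nat_seg[OF gens(1)] by blast
    define R where "R = inv_image less_than idx"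
    have R: "wf R" "total_on A R"
      unfolding R_def using inj_onD[OF idx]
      by (auto simp: total_on_def in_inv_image intro!: wf_inv_image neq_iff[THEN iffD1])
    have "\<forall>w\<in>?L. Morse_geodesic_word G A M w"
      using stable_word_Morse[OF H] by (auto simp: geodesic_language_def Morse_geodesic_word_def)
    moreover have "lex_least_language H R \<subseteq> ?L" unfolding lex_least_language_def[OF H] by blast
    moreover have "\<forall>h\<in>H. \<exists>!w. w \<in> lex_least_language H R \<and> word_elt G w = h"
      using lex_least_unique[OF H R] by simp
    ultimately show ?thesis
      using regular_geodesic_language[OF H] regular_lex_least_language[OF H, of R] Mk(1)
      by (intro conjI exI[of _ M] exI[of _ "lex_least_language H R"])
  qed
  moreover have "stable_subgroup G H"
    if "regular_language A ?L" "morse_gauge M" "\<forall>w\<in>?L. Morse_geodesic_word G A M w" for M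
    using stable_if_regular[OF assms(3) that(1,2)] that(3) by simp
  ultimately show ?thesis by (elim exE conjE | intro conjI impI iffI | assumption | simp)+
qed

end
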